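(* Let $P(\lambda)=\sum_{j=0}^{d}P_j\lambda^j\in\mathbb{C}[\lambda]^{m\times n}$ be a polynomial matrix of normal rank $r$, let $\sigma_1\le\dots\le\sigma_r$ be its structural indices at $\lambda_0=0$, and put $d':=\max_i\sigma_i$. Run the Toeplitz rank search described in the context on $P(\lambda)$ for the steps $i=0,1,\dots,d'$, with the transformations $N_i=\begin{bmatrix} I_{\rho_{i-1}} & Z_iQ_i\\ 0&Q_i\end{bmatrix}$ prescribed there. This choice of transformations produces the factorization $$P(\lambda)N(\lambda)=P^{(d')}(\lambda)\Lambda(\lambda),\qquad \Lambda(\lambda):=\Lambda_0\cdots\Lambda_{d'},\qquad N(\lambda):=N_0\Lambda_0^{-1}N_1\Lambda_1^{-1}\cdots N_{d'}\Lambda_{d'}^{-1}\Lambda(\lambda),$$ where $N(\lambda)$ is unimodular, $$\Lambda(\lambda)=\operatorname{diag}\bigl(I_{e_0},\lambda I_{e_1},\dots,\lambda^{d'-1}I_{e_{d'-1}},\lambda^{d'}I_{\nu_{d'}}\bigr),$$ $e_i:=\rho_i-\rho_{i-1}$ for $i\ge 0$, and the constant matrix $P^{(d')}(0)=\begin{bmatrix}L_0^{(d')} & 0\end{bmatrix}$ has rank $r$ and nullity $n-r$.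
   Context: The normal rank of a matrix over $\mathbb{C}(\lambda)$ is its rank over the field $\mathbb{C}(\lambda)$. A square polynomial matrix is unimodular if its determinant is a nonzero constant. The structural indices of an $m\times n$ rational matrix $R(\lambda)$ of normal rank $r$ at $\lambda_0\in\mathbb{C}$ are the integers $\sigma_1\le\dots\le\sigma_r$ such that $M(\lambda)R(\lambda)N(\lambda)=\operatorname{diag}((\lambda-\lambda_0)^{\sigma_1},\dots,(\lambda-\lambda_0)^{\sigma_r})\oplus 0_{(m-r)\times(n-r)}$ for some square rational matrices $M(\lambda),N(\lambda)$ having no pole at $\lambda_0$ and with $M(\lambda_0),N(\lambda_0)$ invertible. Toeplitz rank search (at $\lambda_0=0$). Put $P^{(-1)}(\lambda):=P(\lambda)$, $\rho_{-1}:=0$, $\nu_{-1}:=n$. For $i=0,1,\dots,d'$ do the following. (1) Partition $P^{(i-1)}(0)=\begin{bmatrix}L_0^{(i-1)} & R_1^{(i-1)}\end{bmatrix}$, where $L_0^{(i-1)}\in\mathbb{C}^{m\times\rho_{i-1}}$ has full column rank $\rho_{i-1}$ and $R_1^{(i-1)}\in\mathbb{C}^{m\times\nu_{i-1}}$ (for $i=0$ the first block is empty and $R_1^{(-1)}=P_0$). (2) Let $Z_i:=-\bigl(L_0^{(i-1)}\bigr)^{\dagger}R_1^{(i-1)}$, where $\dagger$ is the Moore–Penrose inverse (the least squares solution of $L_0^{(i-1)}Z_i=-R_1^{(i-1)}$), and let $Q_i\in\mathbb{C}^{\nu_{i-1}\times\nu_{i-1}}$ be a unitary matrix compressing the columns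 of the projected matrix, that is, $$\bigl(I_m-L_0^{(i-1)}(L_0^{(i-1)})^{\dagger}\bigr)R_1^{(i-1)}Q_i=\begin{bmatrix}L_{0+}^{(i-1)} & 0\end{bmatrix}$$ with $L_{0+}^{(i-1)}$ of full column rank (if the columns of $R_1^{(i-1)}$ lie in the span of those of $L_0^{(i-1)}$, then $Q_i=I_{\nu_{i-1}}$ and $L_{0+}^{(i-1)}$ is empty). Set $$N_i:=\begin{bmatrix} I_{\rho_{i-1}} & Z_i\\ 0& I_{\nu_{i-1}}\end{bmatrix}\begin{bmatrix} I_{\rho_{i-1}} & 0\\ 0& Q_i\end{bmatrix},$$ so that $\begin{bmatrix}L_0^{(i-1)} & R_1^{(i-1)}\end{bmatrix}N_i=\begin{bmatrix}L_0^{(i)} & 0\end{bmatrix}$ with $L_0^{(i)}:=\begin{bmatrix}L_0^{(i-1)} & L_{0+}^{(i-1)}\end{bmatrix}$ of full column rank. Let $\rho_i$ be the number of columns of $L_0^{(i)}$ and $\nu_i:=n-\rho_i$. (3) Let $\Lambda_i(\lambda):=\operatorname{diag}(I_{\rho_i},\lambda I_{\nu_i})$ and define the polynomial matrix $P^{(i)}(\lambda)$ by $P^{(i-1)}(\lambda)N_i=P^{(i)}(\lambda)\Lambda_i(\lambda)$.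
   Formalization: Λ_0⋯Λ_{d'} is corrected to end in λ^{d'}I_{e_{d'}}, λ^{d'+1}I_{ν_{d'}}, and P^{(d')}(0) to [L_0^{(d')} R]; the form [L_0^{(d')} 0] is proved for P^{(d'-1)}N_{d'} at 0, with Λ_0⋯Λ_{d'-1} ending in λ^{d'}I_{ν_{d'-1}}. *)

theory Defs
  imports
    "Jordan_Normal_Form.DL_Rank"
    "Jordan_Normal_Form.Matrix_Kernel"
    "Jordan_Normal_Form.Schur_Decomposition"
    "HOL-Computational_Algebra.Computational_Algebra"
    "HOL-Computational_Algebra.Field_as_Ring"
begin

section \<open>Polynomial and rational matrices\<close>

text \<open>Polynomial matrices are of type \<open>complex poly mat\<close>; the field of rational
  functions is \<open>complex poly fract\<close>.\<close>

abbreviation const_mat :: "complex mat \<Rightarrow> complex poly mat" where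
  "const_mat A \<equiv> map_mat (\<lambda>c. [:c:]) A"

abbreviation rat_mat :: "complex poly mat \<Rightarrow> complex poly fract mat" where
  "rat_mat A \<equiv> map_mat to_fract A"

abbreviation eval_mat :: "complex \<Rightarrow> complex poly mat \<Rightarrow> complex mat" where
  "eval_mat z A \<equiv> map_mat (\<lambda>p. poly p z) A"

abbreviation lam :: "complex poly fract" where
  "lam \<equiv> to_fract [:0, 1:]"

definition normal_rank :: "complex poly fract mat \<Rightarrow> nat" where
  "normal_rank R = vec_space.rank (dim_row R) R"

definition unimodular :: "complex poly mat \<Rightarrow> bool" where
  "unimodular U \<longleftrightarrow> square_mat U \<and> (\<exists>c. c \<noteq> 0 \<and> det U = [:c:])"

text \<open>Poles and values are read off the representation in lowest terms.\<close>

definition no_pole_at :: "complex \<Rightarrow> complex poly fract \<Rightarrow> bool" where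
  "no_pole_at z f \<longleftrightarrow> poly (snd (quot_of_fract f)) z \<noteq> 0"

definition rat_value :: "complex \<Rightarrow> complex poly fract \<Rightarrow> complex" where
  "rat_value z f = poly (fst (quot_of_fract f)) z / poly (snd (quot_of_fract f)) z"

definition regular_at :: "complex \<Rightarrow> complex poly fract mat \<Rightarrow> bool" where
  "regular_at z M \<longleftrightarrow> square_mat M
     \<and> (\<forall>i < dim_row M. \<forall>j < dim_col M. no_pole_at z (M $$ (i, j)))
     \<and> invertible_mat (map_mat (rat_value z) M)"

definition local_smith_form ::
  "nat \<Rightarrow> nat \<Rightarrow> complex \<Rightarrow> int list \<Rightarrow> complex poly fract mat" where
  "local_smith_form m n z \<sigma> = mat m n (\<lambda>(i, j).
     if i = j \<and> i < length \<sigma> then to_fract [:- z, 1:] powi (\<sigma> ! i) else 0)"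

definition structural_indices :: "complex \<Rightarrow> complex poly fract mat \<Rightarrow> int list \<Rightarrow> bool" where
  "structural_indices z R \<sigma> \<longleftrightarrow>
     length \<sigma> = normal_rank R \<and> sorted \<sigma> \<and>
     (\<exists>M N. M \<in> carrier_mat (dim_row R) (dim_row R) \<and> regular_at z M
          \<and> N \<in> carrier_mat (dim_col R) (dim_col R) \<and> regular_at z N
          \<and> M * R * N = local_smith_form (dim_row R) (dim_col R) z \<sigma>)"

section \<open>Constant matrices\<close>

definition hcat :: "'a :: zero mat \<Rightarrow> 'a mat \<Rightarrow> 'a mat" where
  "hcat A B = four_block_mat A B (0\<^sub>m 0 (dim_col A)) (0\<^sub>m 0 (dim_col B))"

definition full_column_rank :: "complex mat \<Rightarrow> bool" where
  "full_column_rank A \<longleftrightarrow> vec_space.rank (dim_row A) A = dim_col A"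

definition moore_penrose :: "complex mat \<Rightarrow> complex mat \<Rightarrow> bool" where
  "moore_penrose A X \<longleftrightarrow> X \<in> carrier_mat (dim_col A) (dim_row A)
     \<and> A * X * A = A \<and> X * A * X = X
     \<and> mat_adjoint (A * X) = A * X \<and> mat_adjoint (X * A) = X * A"

definition unitary_mat :: "nat \<Rightarrow> complex mat \<Rightarrow> bool" where
  "unitary_mat k Q \<longleftrightarrow> Q \<in> carrier_mat k k
     \<and> mat_adjoint Q * Q = 1\<^sub>m k \<and> Q * mat_adjoint Q = 1\<^sub>m k"

section \<open>The Toeplitz rank search at 0\<close>

text \<open>\<open>diag(I\<^sub>\<rho>, x I\<^sub>\<nu>)\<close> with \<open>\<nu> = n - \<rho>\<close>. It is used with \<open>x = \<lambda>\<close>, as a polynomial or as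
  a rational function, and with \<open>x = \<lambda>\<^sup>-\<^sup>1\<close>, which gives the inverse matrix.\<close>

definition step_diag :: "'a :: comm_ring_1 \<Rightarrow> nat \<Rightarrow> nat \<Rightarrow> 'a mat" where
  "step_diag x n \<rho> = diag_block_mat [1\<^sub>m \<rho>, x \<cdot>\<^sub>m 1\<^sub>m (n - \<rho>)]"

definition step_trans :: "nat \<Rightarrow> nat \<Rightarrow> complex mat \<Rightarrow> complex mat \<Rightarrow> complex mat" where
  "step_trans n \<rho> Z Q =
     four_block_mat (1\<^sub>m \<rho>) (Z * Q) (0\<^sub>m (n - \<rho>) \<rho>) Q"

text \<open>One step, leading from \<open>A = P\<^sup>(\<^sup>i\<^sup>-\<^sup>1\<^sup>)\<close> and \<open>L = L\<^sub>0\<^sup>(\<^sup>i\<^sup>-\<^sup>1\<^sup>)\<close> to \<open>A' = P\<^sup>(\<^sup>i\<^sup>)\<close> and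
  \<open>L' = L\<^sub>0\<^sup>(\<^sup>i\<^sup>)\<close>. Here \<open>R\<close> is \<open>R\<^sub>1\<^sup>(\<^sup>i\<^sup>-\<^sup>1\<^sup>)\<close>, \<open>X\<close> is the Moore--Penrose inverse of \<open>L\<close>, and
  \<open>K\<close> is \<open>L\<^sub>0\<^sub>+\<^sup>(\<^sup>i\<^sup>-\<^sup>1\<^sup>)\<close>. The equation that defines the partition constrains only \<open>R\<close>: that
  the leading columns of \<open>A(0)\<close> are those of \<open>L\<close>, and that \<open>L\<close> has full column rank, follows from
  the preceding steps.\<close>

definition toeplitz_step ::
  "nat \<Rightarrow> nat \<Rightarrow> complex poly mat \<Rightarrow> complex mat \<Rightarrow> complex mat \<Rightarrow> complex mat
     \<Rightarrow> complex poly mat \<Rightarrow> complex mat \<Rightarrow> bool" where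
  "toeplitz_step m n A L Z Q A' L' \<longleftrightarrow>
     (\<exists>R X K.
        R \<in> carrier_mat m (n - dim_col L)
      \<and> eval_mat 0 A = hcat L R
      \<and> moore_penrose L X
      \<and> Z = - (X * R)
      \<and> unitary_mat (n - dim_col L) Q
      \<and> K \<in> carrier_mat m (dim_col K) \<and> full_column_rank K
      \<and> dim_col K \<le> n - dim_col L
      \<and> (1\<^sub>m m - L * X) * R * Q = hcat K (0\<^sub>m m (n - dim_col L - dim_col K))
      \<and> (set (cols R) \<subseteq> vec_space.col_space m L \<longrightarrow>
           Q = 1\<^sub>m (n - dim_col L) \<and> dim_col K = 0)
      \<and> L' = hcat L K
      \<and> A' \<in> carrier_mat m n
      \<and> A * const_mat (step_trans n (dim_col L) Z Q) = A' * step_diag [:0, 1:] n (dim_col L'))"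

text \<open>A run consisting of the steps \<open>0, \<dots>, d\<close>. The sequences \<open>A\<close> and \<open>L\<close> are shifted by
  one so as to start at 0: \<open>A i = P\<^sup>(\<^sup>i\<^sup>-\<^sup>1\<^sup>)\<close> and \<open>L i = L\<^sub>0\<^sup>(\<^sup>i\<^sup>-\<^sup>1\<^sup>)\<close>, whereas \<open>Z i\<close> and \<open>Q i\<close> are
  \<open>Z\<^sub>i\<close> and \<open>Q\<^sub>i\<close>.\<close>

definition toeplitz_rank_search ::
  "nat \<Rightarrow> nat \<Rightarrow> complex poly mat \<Rightarrow> nat \<Rightarrow> (nat \<Rightarrow> complex poly mat) \<Rightarrow> (nat \<Rightarrow> complex mat)
     \<Rightarrow> (nat \<Rightarrow> complex mat) \<Rightarrow> (nat \<Rightarrow> complex mat) \<Rightarrow> bool" where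
  "toeplitz_rank_search m n P d A L Z Q \<longleftrightarrow>
     A 0 = P \<and> L 0 = 0\<^sub>m m 0 \<and>
     (\<forall>i\<le>d. toeplitz_step m n (A i) (L i) (Z i) (Q i) (A (Suc i)) (L (Suc i)))"

text \<open>The integers \<open>\<rho>\<^sub>i\<close>, \<open>\<nu>\<^sub>i\<close>, \<open>e\<^sub>i\<close> for \<open>i \<ge> 0\<close> (no shift), and the matrices \<open>N\<^sub>i\<close>, \<open>\<Lambda>\<^sub>i\<close> and
  \<open>\<Lambda>\<^sub>i\<^sup>-\<^sup>1\<close>. The subtraction in \<open>e\<^sub>i\<close> does not truncate, since \<open>L (Suc i)\<close> extends \<open>L i\<close>.\<close>

definition rho_at :: "(nat \<Rightarrow> complex mat) \<Rightarrow> nat \<Rightarrow> nat" where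
  "rho_at L i = dim_col (L (Suc i))"

definition nu_at :: "nat \<Rightarrow> (nat \<Rightarrow> complex mat) \<Rightarrow> nat \<Rightarrow> nat" where
  "nu_at n L i = n - rho_at L i"

definition e_at :: "(nat \<Rightarrow> complex mat) \<Rightarrow> nat \<Rightarrow> nat" where
  "e_at L i = dim_col (L (Suc i)) - dim_col (L i)"

definition N_at ::
  "nat \<Rightarrow> (nat \<Rightarrow> complex mat) \<Rightarrow> (nat \<Rightarrow> complex mat) \<Rightarrow> (nat \<Rightarrow> complex mat) \<Rightarrow> nat
     \<Rightarrow> complex mat" where
  "N_at n L Z Q i = step_trans n (dim_col (L i)) (Z i) (Q i)"

definition Lambda_at :: "nat \<Rightarrow> (nat \<Rightarrow> complex mat) \<Rightarrow> nat \<Rightarrow> complex poly fract mat" where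
  "Lambda_at n L i = step_diag lam n (rho_at L i)"

definition Lambda_inv_at :: "nat \<Rightarrow> (nat \<Rightarrow> complex mat) \<Rightarrow> nat \<Rightarrow> complex poly fract mat" where
  "Lambda_inv_at n L i = step_diag (inverse lam) n (rho_at L i)"

definition mat_list_prod :: "nat \<Rightarrow> 'a :: semiring_1 mat list \<Rightarrow> 'a mat" where
  "mat_list_prod n As = foldr (*) As (1\<^sub>m n)"

text \<open>\<open>\<Lambda>\<^sub>0 \<cdots> \<Lambda>\<^sub>k\<^sub>-\<^sub>1\<close>, a product of \<open>k\<close> factors, so \<open>\<Lambda>(\<lambda>)\<close> for the steps \<open>0, \<dots>, d\<close> has
  \<open>k = Suc d\<close>. Since \<open>P\<^sup>(\<^sup>d\<^sup>) \<Lambda>\<^sub>d = P\<^sup>(\<^sup>d\<^sup>-\<^sup>1\<^sup>) N\<^sub>d\<close>, the factorization may also be normalized with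
  \<open>k = d\<close> and the left factor \<open>P\<^sup>(\<^sup>d\<^sup>-\<^sup>1\<^sup>) N\<^sub>d\<close>. The two normalizations must not be mixed: the value
  of \<open>P\<^sup>(\<^sup>d\<^sup>-\<^sup>1\<^sup>) N\<^sub>d\<close> at 0 is \<open>[L\<^sub>0\<^sup>(\<^sup>d\<^sup>) 0]\<close>, while \<open>P\<^sup>(\<^sup>d\<^sup>)(0) = [L\<^sub>0\<^sup>(\<^sup>d\<^sup>) R]\<close> with \<open>R \<noteq> 0\<close> in
  general, for instance for \<open>P = [1 \<lambda>]\<close>, where \<open>d = 0\<close> and \<open>P\<^sup>(\<^sup>0\<^sup>) = [1 1]\<close> for \<open>Q\<^sub>0 = I\<close>.\<close>

definition Lambda_prod :: "nat \<Rightarrow> (nat \<Rightarrow> complex mat) \<Rightarrow> nat \<Rightarrow> complex poly fract mat" where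
  "Lambda_prod n L k = mat_list_prod n (map (Lambda_at n L) [0..<k])"

definition N_total ::
  "nat \<Rightarrow> (nat \<Rightarrow> complex mat) \<Rightarrow> (nat \<Rightarrow> complex mat) \<Rightarrow> (nat \<Rightarrow> complex mat) \<Rightarrow> nat
     \<Rightarrow> complex poly fract mat" where
  "N_total n L Z Q d =
     mat_list_prod n (map (\<lambda>i. rat_mat (const_mat (N_at n L Z Q i)) * Lambda_inv_at n L i)
                          [0..<Suc d])
     * Lambda_prod n L (Suc d)"

text \<open>\<open>diag(I\<^bsub>e 0\<^esub>, \<lambda> I\<^bsub>e 1\<^esub>, \<dots>, \<lambda>\<^bsup>k-1\<^esup> I\<^bsub>e (k-1)\<^esub>, \<lambda>\<^bsup>k\<^esup> I\<^bsub>\<nu>\<^esub>)\<close>\<close>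

definition power_diag :: "nat \<Rightarrow> (nat \<Rightarrow> nat) \<Rightarrow> nat \<Rightarrow> complex poly fract mat" where
  "power_diag k e \<nu> =
     diag_block_mat (map (\<lambda>i. lam ^ i \<cdot>\<^sub>m 1\<^sub>m (e i)) [0..<k] @ [lam ^ k \<cdot>\<^sub>m 1\<^sub>m \<nu>])"

end

(*
  With D_k the product of the first k matrices Lambda_i, moving the diagonal factors to the right
  turns N_0 Lambda_0^-1 ... N_k Lambda_k^-1 D_(k+1) into a product of the conjugates
  D_i^-1 N_i D_i. The exponents in D_i are largest in the columns on which N_i differs from the
  identity, so each conjugate is polynomial, with the constant determinant of Q_i.

  The projection step keeps the columns of L independent. For the rank, clear denominators in the
  local Smith form, M P W = w diag(lambda^sigma) with polynomial M, W invertible at 0 and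
  w(0) <> 0, and combine it with P U = A Lambda, where U is unimodular.
  Rows of M A beyond r vanish. In a row i <= r and a column j where Lambda has the exponent
  d + 1 > sigma_i, the matrix V = adj(W) U satisfies w lambda^sigma_i V_ij = O(lambda^(d+1)), so
  V_ij(0) = 0. As V(0) is invertible, this zero block leaves at most n - r columns with the
  exponent d + 1, that is rho >= r. So the rho independent columns of M(0) L(0), which live in r
  rows, form a basis, and they span all columns of A(0).
*)

theory Submission
  imports Defs
begin

section \<open>Rank, nullity and injectivity\<close>

text \<open>Independence of the columns as a family; the set of columns would not see repetitions.
  As a kernel condition it makes sense over rings as well as fields.\<close>

definition injective_mat :: "'a :: comm_ring_1 mat \<Rightarrow> bool" where
  "injective_mat A \<longleftrightarrow>
     (\<forall>v \<in> carrier_vec (dim_col A). A *\<^sub>v v = 0\<^sub>v (dim_row A) \<longrightarrow> v = 0\<^sub>v (dim_col A))"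

lemma injective_matI:
  assumes "A \<in> carrier_mat nr nc"
    and "\<And>v. v \<in> carrier_vec nc \<Longrightarrow> A *\<^sub>v v = 0\<^sub>v nr \<Longrightarrow> v = 0\<^sub>v nc"
  shows "injective_mat A"
  using assms by (auto simp: injective_mat_def)

lemma injective_matD:
  assumes "injective_mat A" "A \<in> carrier_mat nr nc" "v \<in> carrier_vec nc" "A *\<^sub>v v = 0\<^sub>v nr"
  shows "v = 0\<^sub>v nc"
  using assms by (auto simp: injective_mat_def)

text \<open>Rank-nullity for the linear map given by \<open>A\<close>: its image is the column space
  and its kernel is \<open>mat_kernel A\<close>.\<close>

lemma rank_plus_kernel_dim:
  fixes A :: "'a :: field mat"
  assumes A: "A \<in> carrier_mat nr nc"
  shows "vec_space.rank nr A + kernel_dim A = nc"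
proof -
  interpret k: kernel nr nc A by unfold_locales (rule A)
  interpret W: vec_space "TYPE('a)" nr .
  have "(\<lambda>v. A *\<^sub>v v) \<in> LinearCombinations.module_hom class_ring k.NC.V W.V"
    using A mult_add_distrib_mat_vec[OF A] mult_mat_vec[OF A]
    by (simp add: LinearCombinations.module_hom_def module_vec_simps)
  then interpret lm: linear_map class_ring k.NC.V W.V "\<lambda>v. A *\<^sub>v v"
    by (intro linear_map.intro mod_hom.intro mod_hom_axioms.intro
        k.NC.vectorspace_axioms W.vectorspace_axioms k.NC.module_axioms W.module_axioms)
  have ker: "lm.ker = mat_kernel A"
    unfolding lm.ker_def mat_kernel[OF A] by (auto simp: module_vec_def)
  have im: "lm.im = W.span (set (cols A))"
    unfolding lm.im_def W.col_space_def[symmetric] W.col_space_eq[OF A] using A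
    by (auto simp: module_vec_def)
  have "vectorspace.dim class_ring (W.vs lm.im) + vectorspace.dim class_ring (k.NC.vs lm.ker)
      = k.NC.dim"
    by (rule lm.rank_nullity) simp
  thus ?thesis
    unfolding ker im W.rank_def k.kernel_dim k.NC.dim_is_n by simp
qed

lemma rank_le_dim_row:
  fixes A :: "'a :: field mat"
  assumes A: "A \<in> carrier_mat nr nc"
  shows "vec_space.rank nr A \<le> nr"
proof -
  interpret W: vec_space "TYPE('a)" nr .
  have c: "set (cols A) \<subseteq> carrier_vec nr" using A cols_dim[of A] by auto
  have "vectorspace.dim class_ring (W.vs (W.span (set (cols A)))) \<le> W.dim"
    by (rule W.subspace_dim[OF W.span_is_subspace[OF c] W.fin_dim W.fin_dim_span_cols[OF A]])
  thus ?thesis unfolding W.rank_def W.dim_is_n .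
qed

text \<open>A basis of the kernel omits zero, so a kernel that contains nothing else has only the
  empty basis.\<close>

lemma kernel_dim_eq_0_iff:
  fixes A :: "'a :: field mat"
  assumes A: "A \<in> carrier_mat nr nc"
  shows "kernel_dim A = 0 \<longleftrightarrow> injective_mat A"
proof -
  interpret k: kernel nr nc A by unfold_locales (rule A)
  obtain B where B: "finite B" "k.basis B" using kernel_basis_exists[OF A] by auto
  have dim: "kernel_dim A = card B" using k.Ker.dim_basis[OF B] by simp
  have sub: "B \<subseteq> mat_kernel A" and span: "k.span B = mat_kernel A" and li: "\<not> k.lin_dep B"
    using B(2) unfolding k.Ker.basis_def by auto
  show ?thesis
  proof
    assume "kernel_dim A = 0"
    hence "B = {}" using dim B by auto
    hence "mat_kernel A = {0\<^sub>v nc}" using span k.Ker.span_empty by simp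
    thus "injective_mat A" by (intro injective_matI[OF A]) (auto simp: mat_kernel[OF A])
  next
    assume "injective_mat A"
    hence "mat_kernel A \<subseteq> {0\<^sub>v nc}" using injective_matD[OF _ A] by (auto simp: mat_kernel[OF A])
    hence "B \<subseteq> {0\<^sub>v nc}" using sub by auto
    moreover have "0\<^sub>v nc \<notin> B"
      using k.Ker.zero_nin_lin_indpt[OF sub li] by (metis UNIV_I singletonD zero_neq_one)
    ultimately have "B = {}" by auto
    thus "kernel_dim A = 0" using dim by simp
  qed
qed

lemma rank_eq_dim_col_iff:
  fixes A :: "'a :: field mat"
  assumes A: "A \<in> carrier_mat nr nc"
  shows "vec_space.rank nr A = nc \<longleftrightarrow> injective_mat A"
  using rank_plus_kernel_dim[OF A] kernel_dim_eq_0_iff[OF A] by auto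

lemma injective_mat_dim_le:
  fixes A :: "'a :: field mat"
  assumes "A \<in> carrier_mat nr nc" "injective_mat A"
  shows "nc \<le> nr"
  using rank_eq_dim_col_iff[OF assms(1)] rank_le_dim_row[OF assms(1)] assms(2) by auto

lemma injective_mat_inverse:
  fixes A :: "'a :: field mat"
  assumes A: "A \<in> carrier_mat n n" and inj: "injective_mat A"
  obtains B where "B \<in> carrier_mat n n" "A * B = 1\<^sub>m n" "B * A = 1\<^sub>m n"
proof -
  have "det A \<noteq> 0"
    using det_0_iff_vec_prod_zero_field[OF A] injective_matD[OF inj A] by auto
  \<comment> \<open>Invertibility comes as membership in the units of a matrix ring;
    \<open>()\<close> fills the extension slot of the ring record.\<close>
  from det_non_zero_imp_unit[OF A this, of "()"] obtain B where
    "B \<in> carrier_mat n n" "A * B = 1\<^sub>m n" "B * A = 1\<^sub>m n"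
    unfolding Units_def ring_mat_def by auto
  thus ?thesis using that by blast
qed

lemma injective_mat_mult:
  assumes A: "A \<in> carrier_mat n m" and B: "B \<in> carrier_mat m k"
    and "injective_mat A" "injective_mat B"
  shows "injective_mat (A * B)"
proof (rule injective_matI[of _ n k])
  fix v assume v: "v \<in> carrier_vec k" and "A * B *\<^sub>v v = 0\<^sub>v n"
  hence "A *\<^sub>v (B *\<^sub>v v) = 0\<^sub>v n" using A B by simp
  hence "B *\<^sub>v v = 0\<^sub>v m" using injective_matD[OF assms(3) A] B v by auto
  thus "v = 0\<^sub>v k" using injective_matD[OF assms(4) B v] by auto
qed (use A B in auto)

lemma det_nonzero_injective_mat:
  fixes A :: "'a :: idom mat"
  assumes A: "A \<in> carrier_mat n n" and "det A \<noteq> 0"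
  shows "injective_mat A"
  using det_0_iff_vec_prod_zero[OF A] assms(2) by (intro injective_matI[OF A]) auto

lemma mult_mat_zero_vec:
  fixes A :: "'a :: comm_ring_1 mat"
  assumes "A \<in> carrier_mat m n"
  shows "A *\<^sub>v 0\<^sub>v n = 0\<^sub>v m"
  using assms by (intro eq_vecI) (auto simp: scalar_prod_def)

section \<open>Horizontal concatenation\<close>

lemma hcat_carrier:
  assumes "A \<in> carrier_mat m a" "B \<in> carrier_mat m b"
  shows "hcat A B \<in> carrier_mat m (a + b)"
  using assms unfolding hcat_def by auto

lemma hcat_index:
  assumes "A \<in> carrier_mat m a" "B \<in> carrier_mat m b" "i < m" "j < a + b"
  shows "hcat A B $$ (i, j) = (if j < a then A $$ (i, j) else B $$ (i, j - a))"
  using assms unfolding hcat_def by auto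

lemma hcat_assoc:
  assumes "A \<in> carrier_mat m a" "B \<in> carrier_mat m b" "C \<in> carrier_mat m c"
  shows "hcat A (hcat B C) = hcat (hcat A B) C"
proof (rule eq_matI)
  have l: "hcat A (hcat B C) \<in> carrier_mat m (a + (b + c))"
    and r: "hcat (hcat A B) C \<in> carrier_mat m (a + b + c)"
    using assms by (meson hcat_carrier)+
  thus "dim_row (hcat A (hcat B C)) = dim_row (hcat (hcat A B) C)"
    "dim_col (hcat A (hcat B C)) = dim_col (hcat (hcat A B) C)" by auto
  fix i j assume "i < dim_row (hcat (hcat A B) C)" "j < dim_col (hcat (hcat A B) C)"
  hence ij: "i < m" "j < a + b + c" using r by auto
  have "hcat A (hcat B C) $$ (i, j)
      = (if j < a then A $$ (i, j) else if j < a + b then B $$ (i, j - a) else C $$ (i, j - a - b))"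
    using hcat_index[OF assms(1) hcat_carrier[OF assms(2,3)], of i j]
      hcat_index[OF assms(2,3), of i "j - a"] ij by auto
  thus "hcat A (hcat B C) $$ (i, j) = hcat (hcat A B) C $$ (i, j)"
    using hcat_index[OF hcat_carrier[OF assms(1,2)] assms(3), of i j]
      hcat_index[OF assms(1,2), of i j] ij by auto
qed

lemma mult_hcat:
  assumes "M \<in> carrier_mat k m" "A \<in> carrier_mat m a" "B \<in> carrier_mat m b"
  shows "M * hcat A B = hcat (M * A) (M * B)"
proof (rule eq_matI)
  have l: "M * hcat A B \<in> carrier_mat k (a + b)"
    and r: "hcat (M * A) (M * B) \<in> carrier_mat k (a + b)"
    using assms by (meson hcat_carrier mult_carrier_mat)+
  thus "dim_row (M * hcat A B) = dim_row (hcat (M * A) (M * B))"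
    "dim_col (M * hcat A B) = dim_col (hcat (M * A) (M * B))" by auto
  fix i j assume "i < dim_row (hcat (M * A) (M * B))" "j < dim_col (hcat (M * A) (M * B))"
  hence ij: "i < k" "j < a + b" using r by auto
  have c: "col (hcat A B) j = (if j < a then col A j else col B (j - a))"
    using assms ij carrier_matD[OF hcat_carrier[OF assms(2,3)]]
    by (intro eq_vecI) (auto simp: hcat_index[OF assms(2,3)])
  show "(M * hcat A B) $$ (i, j) = hcat (M * A) (M * B) $$ (i, j)"
  proof -
    have "(M * hcat A B) $$ (i, j) = row M i \<bullet> col (hcat A B) j"
      using assms(1) ij carrier_matD[OF hcat_carrier[OF assms(2,3)]] by simp
    also have "\<dots> = (if j < a then (M * A) $$ (i, j) else (M * B) $$ (i, j - a))"
      unfolding c using assms ij by auto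
    also have "\<dots> = hcat (M * A) (M * B) $$ (i, j)"
      using assms ij by (subst hcat_index[of _ k a _ b]) auto
    finally show ?thesis .
  qed
qed

lemma hcat_mult_append:
  assumes "A \<in> carrier_mat m a" "B \<in> carrier_mat m b" "x \<in> carrier_vec a" "y \<in> carrier_vec b"
  shows "hcat A B *\<^sub>v (x @\<^sub>v y) = A *\<^sub>v x + B *\<^sub>v y"
proof -
  \<comment> \<open>The lower blocks in \<open>hcat\<close> have no rows, so block multiplication
    appends an empty vector.\<close>
  have "hcat A B *\<^sub>v (x @\<^sub>v y) = (A *\<^sub>v x + B *\<^sub>v y) @\<^sub>v (0\<^sub>m 0 a *\<^sub>v x + 0\<^sub>m 0 b *\<^sub>v y)"
    unfolding hcat_def using assms
    by (subst four_block_mat_mult_vec[of _ m a _ b _ 0]) auto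
  also have "\<dots> = A *\<^sub>v x + B *\<^sub>v y"
    using assms by (intro eq_vecI) auto
  finally show ?thesis .
qed

text \<open>The columns of \<open>A * Y\<close> already lie in the column space of \<open>A\<close>,
  so appending them leaves that space unchanged.\<close>

lemma rank_hcat_mult:
  fixes A :: "'a :: field mat"
  assumes A: "A \<in> carrier_mat m a" and Y: "Y \<in> carrier_mat a b"
  shows "vec_space.rank m (hcat A (A * Y)) = vec_space.rank m A"
proof -
  interpret W: vec_space "TYPE('a)" m .
  have AY: "A * Y \<in> carrier_mat m b" using A Y by simp
  note H = hcat_carrier[OF A AY]
  have "W.col_space (hcat A (A * Y)) = W.col_space A"
    unfolding W.col_space_eq[OF A] W.col_space_eq[OF H]
  proof (intro Collect_cong conj_cong)
    fix y :: "'a vec"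
    show "(\<exists>x\<in>carrier_vec (dim_col (hcat A (A * Y))). hcat A (A * Y) *\<^sub>v x = y)
       \<longleftrightarrow> (\<exists>x\<in>carrier_vec (dim_col A). A *\<^sub>v x = y)"
    proof
      assume "\<exists>x\<in>carrier_vec (dim_col (hcat A (A * Y))). hcat A (A * Y) *\<^sub>v x = y"
      then obtain x where x: "x \<in> carrier_vec (a + b)" "hcat A (A * Y) *\<^sub>v x = y" using H by auto
      define u v where "u = vec_first x a" "v = vec_last x b"
      have uv: "u \<in> carrier_vec a" "v \<in> carrier_vec b" "x = u @\<^sub>v v"
        using x(1) unfolding u_v_def by auto
      have "y = A *\<^sub>v u + A * Y *\<^sub>v v"
        using x(2) hcat_mult_append[OF A AY uv(1,2)] uv(3) by simp
      also have "\<dots> = A *\<^sub>v (u + Y *\<^sub>v v)"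
        using A Y uv by (simp add: mult_add_distrib_mat_vec[OF A])
      finally show "\<exists>x\<in>carrier_vec (dim_col A). A *\<^sub>v x = y"
        using A Y uv by (intro bexI[of _ "u + Y *\<^sub>v v"]) auto
    next
      assume "\<exists>x\<in>carrier_vec (dim_col A). A *\<^sub>v x = y"
      then obtain x where x: "x \<in> carrier_vec a" "A *\<^sub>v x = y" using A by auto
      have "hcat A (A * Y) *\<^sub>v (x @\<^sub>v 0\<^sub>v b) = A *\<^sub>v x + A * Y *\<^sub>v 0\<^sub>v b"
        by (rule hcat_mult_append[OF A AY x(1)]) simp
      also have "A * Y *\<^sub>v 0\<^sub>v b = 0\<^sub>v m" by (rule mult_mat_zero_vec[OF AY])
      finally have "hcat A (A * Y) *\<^sub>v (x @\<^sub>v 0\<^sub>v b) = y" using A x by auto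
      thus "\<exists>x\<in>carrier_vec (dim_col (hcat A (A * Y))). hcat A (A * Y) *\<^sub>v x = y"
        using H x by (intro bexI[of _ "x @\<^sub>v 0\<^sub>v b"]) auto
    qed
  qed (use A H in auto)
  thus ?thesis unfolding W.rank_def W.col_space_def by simp
qed

section \<open>Diagonal matrices\<close>

text \<open>A common entrywise form for the block diagonal matrices of the search; products become
  pointwise products of the functions, and block boundaries become case distinctions on the
  index.\<close>

definition diag_of :: "nat \<Rightarrow> (nat \<Rightarrow> 'a :: zero) \<Rightarrow> 'a mat" where
  "diag_of n f = mat n n (\<lambda>(i, j). if i = j then f i else 0)"

lemma diag_of_carrier [simp]: "diag_of n f \<in> carrier_mat n n"
  by (simp add: diag_of_def)

lemma diag_of_index [simp]:
  "i < n \<Longrightarrow> j < n \<Longrightarrow> diag_of n f $$ (i, j) = (if i = j then f i else 0)"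
  by (simp add: diag_of_def)

lemma diag_of_dims [simp]: "dim_row (diag_of n f) = n" "dim_col (diag_of n f) = n"
  by (simp_all add: diag_of_def)

lemma diag_of_cong: "(\<And>j. j < n \<Longrightarrow> f j = g j) \<Longrightarrow> diag_of n f = diag_of n g"
  by (intro eq_matI) auto

lemma index_mult_diag_of:
  fixes A :: "'a :: semiring_1 mat"
  assumes "A \<in> carrier_mat m n" "i < m" "j < n"
  shows "(A * diag_of n f) $$ (i, j) = A $$ (i, j) * f j"
proof -
  have "(A * diag_of n f) $$ (i, j) = (\<Sum>k = 0..<n. A $$ (i, k) * (if k = j then f k else 0))"
    using assms by (simp add: scalar_prod_def)
  also have "\<dots> = (\<Sum>k = 0..<n. if k = j then A $$ (i, k) * f k else 0)"
    by (intro sum.cong) auto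
  finally show ?thesis using assms by simp
qed

lemma index_diag_of_mult:
  fixes A :: "'a :: semiring_1 mat"
  assumes "A \<in> carrier_mat m n" "i < m" "j < n"
  shows "(diag_of m f * A) $$ (i, j) = f i * A $$ (i, j)"
proof -
  have "(diag_of m f * A) $$ (i, j) = (\<Sum>k = 0..<m. (if i = k then f i else 0) * A $$ (k, j))"
    using assms by (simp add: scalar_prod_def)
  also have "\<dots> = (\<Sum>k = 0..<m. if i = k then f i * A $$ (k, j) else 0)"
    by (intro sum.cong) auto
  finally show ?thesis using assms by simp
qed

lemma diag_of_mult_diag_of:
  fixes f g :: "nat \<Rightarrow> 'a :: semiring_1"
  shows "diag_of n f * diag_of n g = diag_of n (\<lambda>j. f j * g j)"
proof (rule eq_matI)
  fix i j assume "i < dim_row (diag_of n (\<lambda>j. f j * g j))" "j < dim_col (diag_of n (\<lambda>j. f j * g j))"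
  hence "i < n" "j < n" by auto
  thus "(diag_of n f * diag_of n g) $$ (i, j) = diag_of n (\<lambda>j. f j * g j) $$ (i, j)"
    by (subst index_mult_diag_of[of _ n]) auto
qed auto

lemma one_mat_diag_of: "1\<^sub>m n = diag_of n (\<lambda>_. 1)"
  by (intro eq_matI) auto

lemma four_block_diag_of:
  "four_block_mat (diag_of a f) (0\<^sub>m a b) (0\<^sub>m b a) (diag_of b g)
     = diag_of (a + b) (\<lambda>j. if j < a then f j else g (j - a))"
  by (intro eq_matI) auto

lemma index_mult_mat_sum:
  fixes A B :: "'a :: semiring_0 mat"
  assumes "A \<in> carrier_mat m n" "B \<in> carrier_mat n k" "i < m" "j < k"
  shows "(A * B) $$ (i, j) = (\<Sum>l = 0..<n. A $$ (i, l) * B $$ (l, j))"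
  using assms by (simp add: scalar_prod_def)

lemma index_mult_mat_vec_sum:
  fixes A :: "'a :: semiring_0 mat"
  assumes "A \<in> carrier_mat m n" "v \<in> carrier_vec n" "i < m"
  shows "(A *\<^sub>v v) $ i = (\<Sum>l = 0..<n. A $$ (i, l) * v $ l)"
  using assms by (simp add: scalar_prod_def)

lemma index_map_mat_carrier:
  assumes "A \<in> carrier_mat m n" "i < m" "j < n"
  shows "map_mat f A $$ (i, j) = f (A $$ (i, j))"
  using assms by simp

section \<open>Rational functions and polynomials\<close>

interpretation to_fract_hom: inj_comm_ring_hom "to_fract :: 'a :: idom \<Rightarrow> 'a fract"
  by unfold_locales auto

interpretation const_hom: inj_comm_ring_hom "\<lambda>c :: 'a :: comm_ring_1. [:c:]"
  by unfold_locales auto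

lemmas eval_mat_det = comm_ring_hom.hom_det[OF poly_hom.comm_ring_hom_axioms]
lemmas eval_mat_mult = semiring_hom.mat_hom_mult[OF poly_hom.semiring_hom_axioms]

lemma invertible_mat_det_nonzero:
  fixes A :: "'a :: idom mat"
  assumes A: "A \<in> carrier_mat n n" and "invertible_mat A"
  shows "det A \<noteq> 0"
proof -
  obtain B where AB: "A * B = 1\<^sub>m (dim_row A)" and BA: "B * A = 1\<^sub>m (dim_row B)"
    using assms(2) unfolding invertible_mat_def inverts_mat_def by auto
  \<comment> \<open>\<open>inverts_mat\<close> does not fix the shape of the inverse; its dimensions
    are read off the two products.\<close>
  have "dim_col B = n" "dim_row B = n"
    using arg_cong[OF AB, of dim_col] arg_cong[OF BA, of dim_col] A by auto
  hence "B \<in> carrier_mat n n" by auto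
  hence "det A * det B = 1" using det_mult[OF A, of B] AB A by simp
  thus ?thesis by auto
qed

text \<open>Take for \<mu> the product of all entry denominators in lowest terms. None vanishes at
  \<open>z\<close>, so \<mu>(z) is nonzero and \<open>B\<close> at \<open>z\<close> is a nonzero
  multiple of the invertible value matrix of \<open>M\<close>.\<close>

lemma regular_at_clear_denominators:
  assumes M: "M \<in> carrier_mat n n" and reg: "regular_at z M"
  obtains B \<mu> where "B \<in> carrier_mat n n" "poly \<mu> z \<noteq> 0" "rat_mat B = to_fract \<mu> \<cdot>\<^sub>m M"
    "det (eval_mat z B) \<noteq> 0"
proof -
  define num den where "num = (\<lambda>p. fst (quot_of_fract (M $$ p)))"
    and "den = (\<lambda>p. snd (quot_of_fract (M $$ p)))"
  define I where "I = {..<n} \<times> {..<n}"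
  define \<mu> where "\<mu> = prod den I"
  define B where "B = mat n n (\<lambda>p. num p * prod den (I - {p}))"
  have B: "B \<in> carrier_mat n n" unfolding B_def by simp
  have [simp]: "finite I" unfolding I_def by simp
  have dz: "poly (den p) z \<noteq> 0" if "p \<in> I" for p
    using reg that M unfolding I_def regular_at_def no_pole_at_def den_def by auto
  have \<mu>z: "poly \<mu> z \<noteq> 0" unfolding \<mu>_def poly_prod using dz by auto
  have \<mu>: "\<mu> = den p * prod den (I - {p})" if "p \<in> I" for p
    unfolding \<mu>_def using that by (simp add: prod.remove)
  have "rat_mat B = to_fract \<mu> \<cdot>\<^sub>m M"
  proof (rule eq_matI)
    fix i j assume "i < dim_row (to_fract \<mu> \<cdot>\<^sub>m M)" "j < dim_col (to_fract \<mu> \<cdot>\<^sub>m M)"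
    hence ij: "i < n" "j < n" using M by auto
    hence I: "(i, j) \<in> I" unfolding I_def by simp
    have "M $$ (i, j) = quot_to_fract (quot_of_fract (M $$ (i, j)))" by simp
    also have "\<dots> = to_fract (num (i, j)) / to_fract (den (i, j))"
      unfolding quot_to_fract_def num_def den_def Fract_conv_to_fract
      by (simp add: case_prod_unfold)
    finally show "rat_mat B $$ (i, j) = (to_fract \<mu> \<cdot>\<^sub>m M) $$ (i, j)"
      using ij M B dz[OF I] unfolding \<mu>[OF I] B_def by auto
  qed (use M B in auto)
  moreover have "det (eval_mat z B) \<noteq> 0"
  proof -
    have "eval_mat z B = poly \<mu> z \<cdot>\<^sub>m map_mat (rat_value z) M"
    proof (rule eq_matI)
      fix i j assume "i < dim_row (poly \<mu> z \<cdot>\<^sub>m map_mat (rat_value z) M)"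
        "j < dim_col (poly \<mu> z \<cdot>\<^sub>m map_mat (rat_value z) M)"
      hence ij: "i < n" "j < n" using M by auto
      hence I: "(i, j) \<in> I" unfolding I_def by simp
      have "rat_value z (M $$ (i, j)) = poly (num (i, j)) z / poly (den (i, j)) z"
        unfolding rat_value_def num_def den_def ..
      thus "eval_mat z B $$ (i, j) = (poly \<mu> z \<cdot>\<^sub>m map_mat (rat_value z) M) $$ (i, j)"
        using ij M B dz[OF I] unfolding \<mu>[OF I] B_def by auto
    qed (use M B in auto)
    moreover have "det (map_mat (rat_value z) M) \<noteq> 0"
      using reg M unfolding regular_at_def by (intro invertible_mat_det_nonzero[of _ n]) auto
    ultimately show ?thesis using \<mu>z by simp
  qed
  ultimately show ?thesis using that B \<mu>z by blast
qed

lemma smult_mult_smult_mat: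
  fixes A B :: "'a :: comm_ring_1 mat"
  assumes "A \<in> carrier_mat k l" "B \<in> carrier_mat l m"
  shows "(a \<cdot>\<^sub>m A) * (b \<cdot>\<^sub>m B) = (a * b) \<cdot>\<^sub>m (A * B)"
  using assms by (intro eq_matI) auto

text \<open>The scalars that clear the denominators of the two regular factors commute with
  everything and collect in \<open>w\<close>. The adjugate argument below can then work with
  polynomial matrices.\<close>

lemma structural_indices_polynomial_form:
  assumes P: "P \<in> carrier_mat m n" and "structural_indices z (rat_mat P) \<sigma>"
  obtains M W w where "M \<in> carrier_mat m m" "det (eval_mat z M) \<noteq> 0"
    "W \<in> carrier_mat n n" "det (eval_mat z W) \<noteq> 0" "poly w z \<noteq> 0"
    "rat_mat (M * P * W) = to_fract w \<cdot>\<^sub>m local_smith_form m n z \<sigma>"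
proof -
  obtain M W where M: "M \<in> carrier_mat m m" "regular_at z M"
    and W: "W \<in> carrier_mat n n" "regular_at z W"
    and eq: "M * rat_mat P * W = local_smith_form m n z \<sigma>"
    using assms unfolding structural_indices_def by auto
  obtain B \<mu> where B: "B \<in> carrier_mat m m" "poly \<mu> z \<noteq> 0" "rat_mat B = to_fract \<mu> \<cdot>\<^sub>m M"
    "det (eval_mat z B) \<noteq> 0" using regular_at_clear_denominators[OF M] .
  obtain C \<nu> where C: "C \<in> carrier_mat n n" "poly \<nu> z \<noteq> 0" "rat_mat C = to_fract \<nu> \<cdot>\<^sub>m W"
    "det (eval_mat z C) \<noteq> 0" using regular_at_clear_denominators[OF W] .
  have rP: "rat_mat P \<in> carrier_mat m n" using P by simp
  have "rat_mat (B * P * C) = rat_mat B * rat_mat P * rat_mat C"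
    using B(1) P C(1)
    by (simp add: to_fract_hom.mat_hom_mult[of _ m n _ n] to_fract_hom.mat_hom_mult[of _ m m _ n])
  also have "\<dots> = (to_fract \<mu> * to_fract \<nu>) \<cdot>\<^sub>m (M * rat_mat P * W)"
    unfolding B(3) C(3) mult_smult_assoc_mat[OF M(1) rP]
    by (rule smult_mult_smult_mat[of _ m n _ n]) (use M W rP in auto)
  finally have "rat_mat (B * P * C) = to_fract (\<mu> * \<nu>) \<cdot>\<^sub>m local_smith_form m n z \<sigma>"
    by (simp add: eq)
  moreover have "poly (\<mu> * \<nu>) z \<noteq> 0" using B C by simp
  ultimately show ?thesis using that B C by blast
qed

text \<open>The adjugate replaces the inverse of \<open>W\<close>, so that all matrices stay
  polynomial at the cost of the factor \<open>det W\<close>.\<close>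

lemma adj_mat_cancel:
  fixes G W :: "'a :: comm_ring_1 mat"
  assumes G: "G \<in> carrier_mat m n" and W: "W \<in> carrier_mat n n" and U: "U \<in> carrier_mat n k"
  shows "G * W * (adj_mat W * U) = det W \<cdot>\<^sub>m (G * U)"
proof -
  note a = adj_mat[OF W]
  have "G * W * (adj_mat W * U) = G * W * adj_mat W * U"
    by (rule assoc_mult_mat[symmetric, of _ m n _ n _ k]) (use G W U a in auto)
  also have "G * W * adj_mat W = G * (W * adj_mat W)"
    by (rule assoc_mult_mat[of _ m n _ n _ n]) (use G W a in auto)
  also have "\<dots> = det W \<cdot>\<^sub>m G"
    unfolding a(2) using G by (subst mult_smult_distrib[of _ m n _ n]) auto
  also have "\<dots> * U = det W \<cdot>\<^sub>m (G * U)" using G U by (intro mult_smult_assoc_mat)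
  finally show ?thesis .
qed

section \<open>The rank at 0 of a factor whose leading columns are independent\<close>

lemma structural_indices_length:
  assumes "P \<in> carrier_mat m n" and "structural_indices z (rat_mat P) \<sigma>"
  shows "length \<sigma> \<le> m" "length \<sigma> \<le> n"
proof -
  have "rat_mat P \<in> carrier_mat m n" using assms(1) by simp
  from rank_le_dim_row[OF this] vec_space.rank_le_nc[OF this]
  show "length \<sigma> \<le> m" "length \<sigma> \<le> n"
    using assms unfolding structural_indices_def normal_rank_def by auto
qed

text \<open>The rows of the local Smith form beyond the normal rank vanish, and they still do after the
  invertible \<open>W\<close> and \<open>\<Lambda>\<close> are cancelled on the right.\<close>

lemma polynomial_smith_form_zero_rows:
  fixes P B U :: "complex poly mat"
  assumes P: "P \<in> carrier_mat m n" and U: "U \<in> carrier_mat n n" and B: "B \<in> carrier_mat m n"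
    and PU: "P * U = B * diag_of n (\<lambda>j. [:0, 1:] ^ f j)"
    and M: "M \<in> carrier_mat m m" and W: "W \<in> carrier_mat n n" and "det W \<noteq> 0"
    and eq: "rat_mat (M * P * W) = to_fract w \<cdot>\<^sub>m local_smith_form m n z \<sigma>"
    and ij: "length \<sigma> \<le> i" "i < m" "j < n"
  shows "(M * B) $$ (i, j) = 0"
proof -
  have G: "M * P \<in> carrier_mat m n" and GW: "M * P * W \<in> carrier_mat m n" using M P W by auto
  have row: "(M * P * W) $$ (i, k) = 0" if "k < n" for k
  proof -
    have "to_fract ((M * P * W) $$ (i, k)) = rat_mat (M * P * W) $$ (i, k)"
      using M P W ij that by (simp del: index_mult_mat(1))
    also have "\<dots> = 0" unfolding eq using ij that by (simp add: local_smith_form_def)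
    finally show ?thesis by simp
  qed
  have V: "adj_mat W * U \<in> carrier_mat n n" using adj_mat(1)[OF W] U by simp
  have "(det W \<cdot>\<^sub>m (M * P * U)) $$ (i, j) = (M * P * W * (adj_mat W * U)) $$ (i, j)"
    by (simp only: adj_mat_cancel[OF G W U])
  also have "\<dots> = (\<Sum>k = 0..<n. (M * P * W) $$ (i, k) * (adj_mat W * U) $$ (k, j))"
    by (rule index_mult_mat_sum[OF GW V ij(2,3)])
  also have "\<dots> = 0" using row by simp
  \<comment> \<open>Polynomials form an integral domain, so the nonzero \<open>det W\<close>
    cancels; the power of \<lambda> in column \<open>j\<close> cancels in the same way
    below.\<close>
  finally have "(M * P * U) $$ (i, j) = 0"
    using carrier_matD[OF mult_carrier_mat[OF G U]] ij \<open>det W \<noteq> 0\<close> by (simp del: index_mult_mat)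
  moreover have "M * P * U = M * B * diag_of n (\<lambda>j. [:0, 1:] ^ f j)"
    using assoc_mult_mat[OF M P U] assoc_mult_mat[OF M B diag_of_carrier] PU by simp
  ultimately show ?thesis
    using index_mult_diag_of[of "M * B" m n i j] M B ij by simp
qed

text \<open>Entry \<open>(i, j)\<close> of \<open>V = adj W * U\<close> is divisible by \<open>\<lambda>\<^bsup>f j - \<sigma> i\<^esup>\<close>.\<close>

lemma polynomial_smith_form_zero_block:
  fixes P B U :: "complex poly mat"
  assumes P: "P \<in> carrier_mat m n" and U: "U \<in> carrier_mat n n" and B: "B \<in> carrier_mat m n"
    and PU: "P * U = B * diag_of n (\<lambda>j. [:0, 1:] ^ f j)"
    and M: "M \<in> carrier_mat m m" and W: "W \<in> carrier_mat n n" and w: "poly w 0 \<noteq> 0"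
    and eq: "rat_mat (M * P * W) = to_fract w \<cdot>\<^sub>m local_smith_form m n 0 \<sigma>"
    and i: "i < length \<sigma>" "i < m" "i < n" and j: "j < n" and lt: "\<sigma> ! i < int (f j)"
  shows "poly ((adj_mat W * U) $$ (i, j)) 0 = 0"
proof -
  let ?V = "adj_mat W * U"
  have G: "M * P \<in> carrier_mat m n" and GW: "M * P * W \<in> carrier_mat m n"
    and cMB: "M * B \<in> carrier_mat m n" using M P W B by auto
  have V: "?V \<in> carrier_mat n n" using adj_mat(1)[OF W] U by simp
  have row: "to_fract ((M * P * W) $$ (i, k)) = (if i = k then to_fract w * lam powi (\<sigma> ! i) else 0)"
    if "k < n" for k
  proof -
    have "to_fract ((M * P * W) $$ (i, k)) = rat_mat (M * P * W) $$ (i, k)"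
      using M P W i that by (simp del: index_mult_mat(1))
    also have "\<dots> = (if i = k then to_fract w * lam powi (\<sigma> ! i) else 0)"
      unfolding eq using i that by (simp add: local_smith_form_def)
    finally show ?thesis .
  qed
  have MPU: "M * P * U = M * B * diag_of n (\<lambda>j. [:0, 1:] ^ f j)"
    using assoc_mult_mat[OF M P U] assoc_mult_mat[OF M B diag_of_carrier] PU by simp
  \<comment> \<open>Entry \<open>(i, j)\<close> of \<open>M * P * W * ?V\<close> is computed twice:
    through the adjugate and \<open>PU\<close>, and through row \<open>i\<close> of the Smith form,
    which has a single nonzero entry.\<close>
  have "det W * ((M * B) $$ (i, j) * [:0, 1:] ^ f j) = (det W \<cdot>\<^sub>m (M * P * U)) $$ (i, j)"
    unfolding MPU using carrier_matD[OF mult_carrier_mat[OF cMB diag_of_carrier]] i j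
    by (simp add: index_mult_diag_of[OF cMB] del: index_mult_mat)
  also have "\<dots> = (M * P * W * ?V) $$ (i, j)"
    by (simp only: adj_mat_cancel[OF G W U])
  also have "\<dots> = (\<Sum>k = 0..<n. (M * P * W) $$ (i, k) * ?V $$ (k, j))"
    by (rule index_mult_mat_sum[OF GW V i(2) j])
  finally have "to_fract (det W * ((M * B) $$ (i, j) * [:0, 1:] ^ f j))
      = (\<Sum>k = 0..<n. to_fract ((M * P * W) $$ (i, k)) * to_fract (?V $$ (k, j)))"
    by (simp only: to_fract_sum to_fract_mult)
  also have "\<dots> = (\<Sum>k = 0..<n. if i = k
      then to_fract w * lam powi (\<sigma> ! i) * to_fract (?V $$ (k, j)) else 0)"
    by (intro sum.cong) (auto simp: row)
  also have "\<dots> = to_fract w * lam powi (\<sigma> ! i) * to_fract (?V $$ (i, j))" using i by simp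
  finally have *: "to_fract (det W * (M * B) $$ (i, j)) * lam ^ f j
      = to_fract w * lam powi (\<sigma> ! i) * to_fract (?V $$ (i, j))"
    by (simp add: to_fract_hom.hom_power mult.assoc)
  have lam0: "lam \<noteq> 0" by simp
  \<comment> \<open>The excess exponent. Once \<open>lam powi (\<sigma> ! i)\<close> is cancelled in
    the field, the identity is polynomial again, and as \<open>e > 0\<close> its left side vanishes
    at 0, where \<open>w\<close> does not.\<close>
  define e where "e = nat (int (f j) - \<sigma> ! i)"
  have e: "int (f j) = \<sigma> ! i + int e" "e > 0" using lt unfolding e_def by auto
  have "lam ^ f j = lam powi (int (f j))" by simp
  also have "\<dots> = lam powi (\<sigma> ! i) * lam ^ e" unfolding e(1) using lam0
    by (subst power_int_add) auto
  finally have "lam powi (\<sigma> ! i) * (to_fract (det W * (M * B) $$ (i, j)) * lam ^ e)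
      = lam powi (\<sigma> ! i) * (to_fract w * to_fract (?V $$ (i, j)))"
    using * by (simp add: mult_ac)
  hence "to_fract (det W * (M * B) $$ (i, j)) * lam ^ e = to_fract w * to_fract (?V $$ (i, j))"
    using lam0 by (simp add: power_int_eq_0_iff)
  hence "to_fract (det W * (M * B) $$ (i, j) * [:0, 1:] ^ e) = to_fract (w * ?V $$ (i, j))"
    by (simp only: to_fract_hom.hom_power to_fract_mult)
  hence "det W * (M * B) $$ (i, j) * [:0, 1:] ^ e = w * ?V $$ (i, j)"
    by (simp only: to_fract_eq_iff)
  from arg_cong[OF this, of "\<lambda>p. poly p 0"] show ?thesis using w e(2) by (simp add: power_0_left)
qed

text \<open>The last \<open>n - \<rho>\<close> columns of \<open>V\<close> are independent but live
  only in the last \<open>n - r\<close> rows. The block \<open>T\<close> that they occupy there is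
  therefore injective, which forces \<open>n - \<rho> \<le> n - r\<close>.\<close>

lemma zero_block_bound:
  fixes V :: "'a :: field mat"
  assumes V: "V \<in> carrier_mat n n" and det: "det V \<noteq> 0"
    and zero: "\<And>i j. i < r \<Longrightarrow> \<rho> \<le> j \<Longrightarrow> j < n \<Longrightarrow> V $$ (i, j) = 0"
    and r: "r \<le> n" and \<rho>: "\<rho> \<le> n"
  shows "r \<le> \<rho>"
proof -
  define T where "T = mat (n - r) (n - \<rho>) (\<lambda>(i, j). V $$ (i + r, j + \<rho>))"
  have T: "T \<in> carrier_mat (n - r) (n - \<rho>)" unfolding T_def by simp
  have "injective_mat T"
  proof (rule injective_matI[OF T])
    fix v assume v: "v \<in> carrier_vec (n - \<rho>)" and Tv: "T *\<^sub>v v = 0\<^sub>v (n - r)"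
    \<comment> \<open>Padding with zeros selects the last columns of \<open>V\<close>: the first
      \<open>r\<close> entries of \<open>V *\<^sub>v u\<close> vanish by \<open>zero\<close>, the
      others are those of \<open>T *\<^sub>v v\<close>.\<close>
    define u where "u = 0\<^sub>v \<rho> @\<^sub>v v"
    have u: "u \<in> carrier_vec n"
      using append_carrier_vec[OF zero_carrier_vec[of \<rho>] v] \<rho> unfolding u_def by simp
    have ev: "(V *\<^sub>v u) $ i = (\<Sum>j = 0..<n - \<rho>. V $$ (i, j + \<rho>) * v $ j)" if "i < n" for i
    proof -
      have "(V *\<^sub>v u) $ i = (\<Sum>j = 0..<n. V $$ (i, j) * u $ j)"
        using V u that by (intro index_mult_mat_vec_sum)
      also have "\<dots> = (\<Sum>j = \<rho>..<n. V $$ (i, j) * u $ j)"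
        by (rule sum.mono_neutral_right) (use v \<rho> in \<open>auto simp: u_def\<close>)
      also have "\<dots> = (\<Sum>j = 0..<n - \<rho>. V $$ (i, j + \<rho>) * u $ (j + \<rho>))"
        using sum.shift_bounds_nat_ivl[of "\<lambda>j. V $$ (i, j) * u $ j" 0 \<rho> "n - \<rho>"] \<rho> by simp
      also have "\<dots> = (\<Sum>j = 0..<n - \<rho>. V $$ (i, j + \<rho>) * v $ j)"
        by (rule sum.cong) (use v \<rho> in \<open>auto simp: u_def\<close>)
      finally show ?thesis .
    qed
    have "V *\<^sub>v u = 0\<^sub>v n"
    proof (rule eq_vecI)
      fix i assume "i < dim_vec (0\<^sub>v n :: 'a vec)"
      hence i: "i < n" by simp
      show "(V *\<^sub>v u) $ i = 0\<^sub>v n $ i"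
      proof (cases "i < r")
        case True
        have "(V *\<^sub>v u) $ i = 0" unfolding ev[OF i]
          by (rule sum.neutral) (use True zero in auto)
        thus ?thesis using i by simp
      next
        case False
        have "0 = (T *\<^sub>v v) $ (i - r)" unfolding Tv using i False by simp
        also have "\<dots> = (\<Sum>j = 0..<n - \<rho>. V $$ (i, j + \<rho>) * v $ j)"
          using T v i False by (simp add: scalar_prod_def T_def)
        finally show ?thesis using ev[OF i] i by simp
      qed
    qed (use V in auto)
    hence "u = 0\<^sub>v n" using injective_matD[OF det_nonzero_injective_mat[OF V det] V u] by simp
    hence "u $ (j + \<rho>) = 0" if "j < n - \<rho>" for j using that by simp
    thus "v = 0\<^sub>v (n - \<rho>)" using v \<rho> unfolding u_def by (intro eq_vecI) auto
  qed
  from injective_mat_dim_le[OF T this] show ?thesis using r \<rho> by linarith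
qed

text \<open>The first \<open>r\<close> rows of \<open>M L\<close> form a square injective, hence invertible, matrix.\<close>

lemma columns_spanned:
  fixes M L R :: "'a :: field mat"
  assumes M: "M \<in> carrier_mat m m" and det: "det M \<noteq> 0"
    and L: "L \<in> carrier_mat m \<rho>" and inj: "injective_mat L" and R: "R \<in> carrier_mat m k"
    and zero: "\<And>i j. r \<le> i \<Longrightarrow> i < m \<Longrightarrow> j < \<rho> + k \<Longrightarrow> (M * hcat L R) $$ (i, j) = 0"
    and r: "r \<le> m" and \<rho>: "r \<le> \<rho>"
  shows "\<rho> = r" "\<exists>Y \<in> carrier_mat \<rho> k. R = L * Y"
proof -
  have eL: "M * L \<in> carrier_mat m \<rho>" and eR: "M * R \<in> carrier_mat m k" using M L R by auto
  have zL: "(M * L) $$ (i, j) = 0" if "r \<le> i" "i < m" "j < \<rho>" for i j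
    using zero[of i j] hcat_index[OF eL eR, of i j] that unfolding mult_hcat[OF M L R] by simp
  have zR: "(M * R) $$ (i, j) = 0" if "r \<le> i" "i < m" "j < k" for i j
    using zero[of i "j + \<rho>"] hcat_index[OF eL eR, of i "j + \<rho>"] that
    unfolding mult_hcat[OF M L R] by simp
  have M_inj: "injective_mat M" by (rule det_nonzero_injective_mat[OF M det])
  define T S where "T = mat r \<rho> (\<lambda>ij. (M * L) $$ ij)" and "S = mat r k (\<lambda>ij. (M * R) $$ ij)"
  have T: "T \<in> carrier_mat r \<rho>" and S: "S \<in> carrier_mat r k" unfolding T_def S_def by auto
  have T_mult: "(M * L * Y) $$ (i, j) = (if i < r then (T * Y) $$ (i, j) else 0)"
    if "Y \<in> carrier_mat \<rho> l" "i < m" "j < l" for Y l i j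
  proof -
    have "(M * L * Y) $$ (i, j) = (\<Sum>k = 0..<\<rho>. (M * L) $$ (i, k) * Y $$ (k, j))"
      using eL that by (intro index_mult_mat_sum)
    thus ?thesis using that T zL by (auto simp: scalar_prod_def T_def)
  qed
  have "injective_mat T"
  proof (rule injective_matI[OF T])
    fix v assume v: "v \<in> carrier_vec \<rho>" and Tv: "T *\<^sub>v v = 0\<^sub>v r"
    \<comment> \<open>The rows of \<open>M * L\<close> from \<open>r\<close> on are zero, so its
      first \<open>r\<close> rows determine its kernel.\<close>
    have "M * L *\<^sub>v v = 0\<^sub>v m"
    proof (rule eq_vecI)
      fix i assume "i < dim_vec (0\<^sub>v m :: 'a vec)"
      hence i: "i < m" by simp
      have "(M * L *\<^sub>v v) $ i = (\<Sum>k = 0..<\<rho>. (M * L) $$ (i, k) * v $ k)"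
        using eL v i by (intro index_mult_mat_vec_sum)
      also have "\<dots> = 0"
      proof (cases "i < r")
        case True
        have "(\<Sum>k = 0..<\<rho>. (M * L) $$ (i, k) * v $ k) = (T *\<^sub>v v) $ i"
          using T v True by (simp add: scalar_prod_def T_def)
        thus ?thesis unfolding Tv using True by simp
      next
        case False
        thus ?thesis using zL i by simp
      qed
      finally show "(M * L *\<^sub>v v) $ i = 0\<^sub>v m $ i" using i by simp
    qed (use eL in auto)
    thus "v = 0\<^sub>v \<rho>" by (rule injective_matD[OF injective_mat_mult[OF M L M_inj inj] eL v])
  qed
  \<comment> \<open>An injective matrix with \<open>r\<close> rows has at most \<open>r\<close>
    columns; the converse inequality is assumed.\<close>
  from injective_mat_dim_le[OF T this] show \<rho>r: "\<rho> = r" using \<rho> by simp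
  obtain T' where T': "T' \<in> carrier_mat r r" "T * T' = 1\<^sub>m r"
    using injective_mat_inverse[of T r] T \<open>injective_mat T\<close> \<rho>r by metis
  obtain M' where M': "M' \<in> carrier_mat m m" "M' * M = 1\<^sub>m m"
    using injective_mat_inverse[OF M M_inj] by metis
  \<comment> \<open>The solution of \<open>T * Y = S\<close>. It gives
    \<open>M * L * Y = M * R\<close>, since both sides vanish from row \<open>r\<close> on, and then
    \<open>M\<close> cancels.\<close>
  define Y where "Y = T' * S"
  have Y: "Y \<in> carrier_mat \<rho> k" using T' S \<rho>r unfolding Y_def by simp
  have "T * Y = T * T' * S"
    unfolding Y_def by (rule assoc_mult_mat[symmetric, of _ r r _ r _ k]) (use T T' S \<rho>r in auto)
  hence TY: "T * Y = S" using T'(2) S by simp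
  have "M * L * Y = M * R"
  proof (rule eq_matI)
    fix i j assume "i < dim_row (M * R)" "j < dim_col (M * R)"
    hence "i < m" "j < k" using eR by auto
    thus "(M * L * Y) $$ (i, j) = (M * R) $$ (i, j)"
      using T_mult[OF Y, of i j] zR[of i j] unfolding TY S_def by (cases "i < r") auto
  qed (use eL Y eR in auto)
  hence "M' * (M * (L * Y)) = M' * (M * R)" using assoc_mult_mat[OF M L Y] by simp
  hence "M' * M * (L * Y) = M' * M * R"
    using assoc_mult_mat[OF M'(1) M R] assoc_mult_mat[OF M'(1) M mult_carrier_mat[OF L Y]] by simp
  hence "R = L * Y" using M'(2) R left_mult_one_mat[OF mult_carrier_mat[OF L Y]] by simp
  thus "\<exists>Y \<in> carrier_mat \<rho> k. R = L * Y" using Y by blast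
qed

text \<open>The large exponents in the columns from \<rho> on create a zero block in
  \<open>adj_mat W * U\<close> at 0, hence \<open>length \<sigma> \<le> \<rho>\<close>. The zero
  rows of \<open>M * B\<close> confine the columns of \<open>B\<close> at 0 to dimension
  \<open>length \<sigma>\<close>, which the independent columns of \<open>L\<close> must then
  fill.\<close>

lemma rank_at_zero_of_factor:
  assumes P: "P \<in> carrier_mat m n" and \<sigma>: "structural_indices 0 (rat_mat P) \<sigma>"
    and U: "U \<in> carrier_mat n n" and detU: "poly (det U) 0 \<noteq> 0" and B: "B \<in> carrier_mat m n"
    and PU: "P * U = B * diag_of n (\<lambda>j. [:0, 1:] ^ f j)"
    and \<rho>: "\<rho> \<le> n" and f: "\<And>s j. s \<in> set \<sigma> \<Longrightarrow> \<rho> \<le> j \<Longrightarrow> j < n \<Longrightarrow> s < int (f j)"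
    and L: "L \<in> carrier_mat m \<rho>" and inj: "injective_mat L" and R: "R \<in> carrier_mat m (n - \<rho>)"
    and B0: "eval_mat 0 B = hcat L R"
  shows "\<rho> = length \<sigma>" "\<exists>Y \<in> carrier_mat \<rho> (n - \<rho>). R = L * Y"
proof -
  obtain M W w where M: "M \<in> carrier_mat m m" "det (eval_mat 0 M) \<noteq> 0"
    and W: "W \<in> carrier_mat n n" "det (eval_mat 0 W) \<noteq> 0" and w: "poly w 0 \<noteq> 0"
    and eq: "rat_mat (M * P * W) = to_fract w \<cdot>\<^sub>m local_smith_form m n 0 \<sigma>"
    using structural_indices_polynomial_form[OF P \<sigma>] .
  note len = structural_indices_length[OF P \<sigma>]
  let ?V = "adj_mat W * U"
  note a = adj_mat[OF W(1)]
  have V: "?V \<in> carrier_mat n n" using a(1) U by simp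
  have dW: "poly (det W) 0 \<noteq> 0" using W(2) unfolding eval_mat_det .
  have dW0: "det W \<noteq> 0" using dW by auto
  \<comment> \<open>This determinant identity shows that the adjugate is invertible at 0, because
    \<open>W\<close> is.\<close>
  have "det (adj_mat W) * det W = det W ^ n"
    using det_mult[OF a(1) W(1)] a(3) by simp
  hence "poly (det (adj_mat W)) 0 * poly (det W) 0 = poly (det W) 0 ^ n"
    by (metis poly_mult poly_power)
  hence "poly (det (adj_mat W)) 0 \<noteq> 0" using dW by auto
  hence dV: "det (eval_mat 0 ?V) \<noteq> 0" using det_mult[OF a(1) U] detU unfolding eval_mat_det by simp
  have "length \<sigma> \<le> \<rho>"
  proof (rule zero_block_bound[OF _ dV _ len(2) \<rho>])
    fix i j assume "i < length \<sigma>" "\<rho> \<le> j" "j < n"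
    thus "eval_mat 0 ?V $$ (i, j) = 0"
      using polynomial_smith_form_zero_block[OF P U B PU M(1) W(1) w eq, of i j] f len
      by (simp add: index_map_mat_carrier[OF V])
  qed (use V in simp)
  moreover have "(eval_mat 0 M * hcat L R) $$ (i, j) = 0"
    if "length \<sigma> \<le> i" "i < m" "j < \<rho> + (n - \<rho>)" for i j
  proof -
    have cMB: "M * B \<in> carrier_mat m n" using M B by simp
    have "(M * B) $$ (i, j) = 0"
      using polynomial_smith_form_zero_rows[OF P U B PU M(1) W(1) dW0 eq, of i j] that \<rho> by auto
    hence "eval_mat 0 (M * B) $$ (i, j) = 0" using that \<rho> by (simp add: index_map_mat_carrier[OF cMB])
    thus ?thesis unfolding B0[symmetric] eval_mat_mult[OF M(1) B] .
  qed
  moreover have "eval_mat 0 M \<in> carrier_mat m m" using M by simp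
  ultimately show "\<rho> = length \<sigma>" "\<exists>Y \<in> carrier_mat \<rho> (n - \<rho>). R = L * Y"
    using columns_spanned[OF _ M(2) L inj R _ len(1)] by auto
qed

section \<open>One step of the search\<close>

lemma step_diag_eq_diag_of:
  assumes "\<rho> \<le> n"
  shows "step_diag x n \<rho> = diag_of n (\<lambda>j. if j < \<rho> then 1 else x)"
  unfolding step_diag_def using assms by (intro eq_matI) (auto simp: Let_def)

lemma full_column_rank_iff_injective: "full_column_rank A \<longleftrightarrow> injective_mat A"
  unfolding full_column_rank_def by (rule rank_eq_dim_col_iff) auto

lemma unitary_mat_det_nonzero:
  assumes "unitary_mat k Q"
  shows "det Q \<noteq> 0"
proof -
  have Q: "Q \<in> carrier_mat k k" "mat_adjoint Q * Q = 1\<^sub>m k" "Q * mat_adjoint Q = 1\<^sub>m k"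
    using assms unfolding unitary_mat_def by auto
  have "dim_row (mat_adjoint Q) = k" using arg_cong[OF Q(2), of dim_row] by simp
  thus ?thesis using Q
    by (intro invertible_mat_det_nonzero[OF Q(1)])
      (auto simp: invertible_mat_def inverts_mat_def square_mat.simps)
qed

text \<open>The columns of \<open>K\<close> lie in the kernel of the projection \<open>L X\<close>, which fixes \<open>L\<close>.\<close>

lemma injective_mat_hcat_projected:
  fixes L K X :: "'a :: field mat"
  assumes L: "L \<in> carrier_mat m \<rho>" and X: "X \<in> carrier_mat \<rho> m" and LXL: "L * X * L = L"
    and B: "B \<in> carrier_mat m (k + l)" and K: "K \<in> carrier_mat m k" and J: "J \<in> carrier_mat m l"
    and eq: "(1\<^sub>m m - L * X) * B = hcat K J"
    and inj: "injective_mat L" "injective_mat K"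
  shows "injective_mat (hcat L K)"
proof (rule injective_matI[OF hcat_carrier[OF L K]])
  have LX: "L * X \<in> carrier_mat m m" using L X by simp
  \<comment> \<open>\<open>L * X\<close> is idempotent because \<open>X\<close> is a generalized
    inverse, so it annihilates \<open>1\<^sub>m m - L * X\<close> and with it the columns of
    \<open>K\<close>.\<close>
  have "L * X * (L * X) = L * X"
    using assoc_mult_mat[OF LX L X] LXL by simp
  hence "L * X * (1\<^sub>m m - L * X) = 0\<^sub>m m m"
    unfolding mult_minus_distrib_mat[OF LX one_carrier_mat LX] right_mult_one_mat[OF LX]
    by (simp only: minus_r_inv_mat[OF LX])
  moreover have "L * X * ((1\<^sub>m m - L * X) * B) = L * X * (1\<^sub>m m - L * X) * B"
    by (rule assoc_mult_mat[symmetric, OF LX minus_carrier_mat[OF LX] B])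
  ultimately have "hcat (L * X * K) (L * X * J) = 0\<^sub>m m (k + l)"
    unfolding eq mult_hcat[OF LX K J] using B by simp
  hence zero: "hcat (L * X * K) (L * X * J) $$ (i, j) = 0" if "i < m" "j < k + l" for i j
    using that by simp
  have LXK: "L * X * K = 0\<^sub>m m k"
  proof (rule eq_matI)
    fix i j assume "i < dim_row (0\<^sub>m m k :: 'a mat)" "j < dim_col (0\<^sub>m m k :: 'a mat)"
    thus "(L * X * K) $$ (i, j) = 0\<^sub>m m k $$ (i, j)"
      using zero[of i j] hcat_index[OF mult_carrier_mat[OF LX K] mult_carrier_mat[OF LX J], of i j]
      by simp
  qed (use L K in auto)
  fix x assume x: "x \<in> carrier_vec (\<rho> + k)" and Hx: "hcat L K *\<^sub>v x = 0\<^sub>v m"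
  define u v where "u = vec_first x \<rho>" and "v = vec_last x k"
  have u: "u \<in> carrier_vec \<rho>" and v: "v \<in> carrier_vec k" and xuv: "x = u @\<^sub>v v"
    using x unfolding u_def v_def by auto
  have Luv: "L *\<^sub>v u + K *\<^sub>v v = 0\<^sub>v m" using Hx hcat_mult_append[OF L K u v] xuv by simp
  \<comment> \<open>Applying the projection to a vanishing combination of the columns keeps the part
    from \<open>L\<close> and removes the part from \<open>K\<close>; the two parts vanish
    separately.\<close>
  have "L *\<^sub>v u + 0\<^sub>v m = L * X *\<^sub>v (L *\<^sub>v u) + L * X *\<^sub>v (K *\<^sub>v v)"
  proof -
    have "0\<^sub>m m k *\<^sub>v v = 0\<^sub>v m" using v by (intro eq_vecI) auto
    thus ?thesis
      unfolding assoc_mult_mat_vec[OF LX L u, symmetric] assoc_mult_mat_vec[OF LX K v, symmetric]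
        LXL LXK by simp
  qed
  also have "\<dots> = L * X *\<^sub>v (L *\<^sub>v u + K *\<^sub>v v)"
    by (rule mult_add_distrib_mat_vec[symmetric, OF LX]) (use L K u v in auto)
  also have "\<dots> = 0\<^sub>v m" unfolding Luv by (rule mult_mat_zero_vec[OF LX])
  finally have Lu: "L *\<^sub>v u = 0\<^sub>v m" using L u by simp
  hence "K *\<^sub>v v = 0\<^sub>v m" using Luv K v by simp
  hence "v = 0\<^sub>v k" by (rule injective_matD[OF inj(2) K v])
  moreover have "u = 0\<^sub>v \<rho>" by (rule injective_matD[OF inj(1) L u Lu])
  ultimately show "x = 0\<^sub>v (\<rho> + k)" unfolding xuv by (intro eq_vecI) auto
qed

lemma hcat_mult_step_trans:
  assumes L: "L \<in> carrier_mat m \<rho>" and R: "R \<in> carrier_mat m (n - \<rho>)"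
    and Z: "Z \<in> carrier_mat \<rho> (n - \<rho>)" and Q: "Q \<in> carrier_mat (n - \<rho>) (n - \<rho>)"
  shows "hcat L R * step_trans n \<rho> Z Q = hcat L ((L * Z + R) * Q)"
proof -
  have ZQ: "Z * Q \<in> carrier_mat \<rho> (n - \<rho>)" using Z Q by simp
  have "hcat L R * step_trans n \<rho> Z Q
      = four_block_mat (L * 1\<^sub>m \<rho> + R * 0\<^sub>m (n - \<rho>) \<rho>) (L * (Z * Q) + R * Q)
         (0\<^sub>m 0 (dim_col L) * 1\<^sub>m \<rho> + 0\<^sub>m 0 (dim_col R) * 0\<^sub>m (n - \<rho>) \<rho>)
         (0\<^sub>m 0 (dim_col L) * (Z * Q) + 0\<^sub>m 0 (dim_col R) * Q)"
    unfolding hcat_def step_trans_def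
    by (rule mult_four_block_mat[of _ m \<rho> _ "n - \<rho>" _ 0]) (use L R Z Q ZQ in auto)
  also have "L * 1\<^sub>m \<rho> + R * 0\<^sub>m (n - \<rho>) \<rho> = L" using L R by simp
  also have "L * (Z * Q) + R * Q = (L * Z + R) * Q"
    using assoc_mult_mat[OF L Z Q] add_mult_distrib_mat[OF mult_carrier_mat[OF L Z] R Q] by simp
  also have "0\<^sub>m 0 (dim_col L) * 1\<^sub>m \<rho> + 0\<^sub>m 0 (dim_col R) * 0\<^sub>m (n - \<rho>) \<rho> = 0\<^sub>m 0 (dim_col L)"
    using L R by (intro eq_matI) auto
  also have "0\<^sub>m 0 (dim_col L) * (Z * Q) + 0\<^sub>m 0 (dim_col R) * Q = 0\<^sub>m 0 (dim_col ((L * Z + R) * Q))"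
    using L R Z Q by (intro eq_matI) auto
  finally show ?thesis unfolding hcat_def[of L "(L * Z + R) * Q"] .
qed

lemma step_trans_carrier:
  assumes "\<rho> \<le> n" "Z \<in> carrier_mat \<rho> (n - \<rho>)" "Q \<in> carrier_mat (n - \<rho>) (n - \<rho>)"
  shows "step_trans n \<rho> Z Q \<in> carrier_mat n n"
proof -
  have "step_trans n \<rho> Z Q \<in> carrier_mat (\<rho> + (n - \<rho>)) (\<rho> + (n - \<rho>))"
    unfolding step_trans_def by (rule four_block_carrier_mat) (use assms in auto)
  thus ?thesis using assms(1) by simp
qed

text \<open>All that the induction over the steps must carry. The least squares choice of
  \<open>Z\<close> replaces \<open>R\<close> by its projection, which \<open>Q\<close> compresses,
  so that \<open>A * const_mat N\<close> at 0 is \<open>hcat L' 0\<close>. Dividing by the diagonal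
  factor leaves the leading columns unchanged.\<close>

lemma toeplitz_step_invariants:
  assumes step: "toeplitz_step m n A L Z Q A' L'"
    and A: "A \<in> carrier_mat m n" and L: "L \<in> carrier_mat m \<rho>" and \<rho>: "\<rho> \<le> n"
    and inj: "injective_mat L"
  defines "N \<equiv> step_trans n \<rho> Z Q" and "\<rho>' \<equiv> dim_col L'"
  shows "Z \<in> carrier_mat \<rho> (n - \<rho>)" "Q \<in> carrier_mat (n - \<rho>) (n - \<rho>)" "det Q \<noteq> 0"
    "A' \<in> carrier_mat m n" "L' \<in> carrier_mat m \<rho>'" "\<rho> \<le> \<rho>'" "\<rho>' \<le> n" "injective_mat L'"
    "A * const_mat N = A' * step_diag [:0, 1:] n \<rho>'"
    "eval_mat 0 (A * const_mat N) = hcat L' (0\<^sub>m m (n - \<rho>'))"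
    "\<exists>R \<in> carrier_mat m (n - \<rho>'). eval_mat 0 A' = hcat L' R"
proof -
  let ?\<nu> = "n - \<rho>"
  obtain R X K where R: "R \<in> carrier_mat m ?\<nu>" and A0: "eval_mat 0 A = hcat L R"
    and mp: "moore_penrose L X" and Z: "Z = - (X * R)" and uQ: "unitary_mat ?\<nu> Q"
    and K: "K \<in> carrier_mat m (dim_col K)" and Kf: "full_column_rank K"
    and Kn: "dim_col K \<le> ?\<nu>"
    and comp: "(1\<^sub>m m - L * X) * R * Q = hcat K (0\<^sub>m m (?\<nu> - dim_col K))"
    and L': "L' = hcat L K" and A': "A' \<in> carrier_mat m n"
    and AN: "A * const_mat N = A' * step_diag [:0, 1:] n \<rho>'"
    using step
    unfolding toeplitz_step_def carrier_matD(2)[OF L] N_def[symmetric] \<rho>'_def[symmetric]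
    by (elim exE conjE) (rule that)
  have X: "X \<in> carrier_mat \<rho> m" and LXL: "L * X * L = L"
    using mp L unfolding moore_penrose_def by auto
  have cQ: "Q \<in> carrier_mat ?\<nu> ?\<nu>" using uQ unfolding unitary_mat_def by simp
  have cZ: "Z \<in> carrier_mat \<rho> ?\<nu>" using X R unfolding Z by simp
  have cL': "L' \<in> carrier_mat m (\<rho> + dim_col K)" unfolding L' by (rule hcat_carrier[OF L K])
  hence \<rho>': "\<rho>' = \<rho> + dim_col K" unfolding \<rho>'_def by auto
  have LX: "L * X \<in> carrier_mat m m" using L X by simp
  have N: "N \<in> carrier_mat n n" unfolding N_def by (rule step_trans_carrier[OF \<rho> cZ cQ])
  show "Z \<in> carrier_mat \<rho> (n - \<rho>)" "Q \<in> carrier_mat (n - \<rho>) (n - \<rho>)" "det Q \<noteq> 0"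
    "A' \<in> carrier_mat m n" "L' \<in> carrier_mat m \<rho>'" "\<rho> \<le> \<rho>'"
    "A * const_mat N = A' * step_diag [:0, 1:] n \<rho>'"
    using cZ cQ unitary_mat_det_nonzero[OF uQ] A' cL' \<rho>' AN by auto
  show \<rho>'n: "\<rho>' \<le> n" using Kn \<rho> \<rho>' by simp
  have "(1\<^sub>m m - L * X) * (R * Q) = hcat K (0\<^sub>m m (?\<nu> - dim_col K))"
    unfolding comp[symmetric] by (rule assoc_mult_mat[symmetric, OF minus_carrier_mat[OF LX] R cQ])
  thus "injective_mat L'"
    unfolding L' using R cQ Kn Kf inj full_column_rank_iff_injective
    by (intro injective_mat_hcat_projected[OF L X LXL _ K, of "R * Q" "?\<nu> - dim_col K"]) auto
  have "L * Z = - (L * X * R)"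
    unfolding Z using L X R assoc_mult_mat[OF L X R] by simp
  \<comment> \<open>The elimination by \<open>Z\<close> is exactly the projection onto the
    complement of the column space of \<open>L\<close>.\<close>
  hence "L * Z + R = (1\<^sub>m m - L * X) * R"
    unfolding minus_mult_distrib_mat[OF one_carrier_mat LX R] using L X R
    by (intro eq_matI) auto
  hence LZ: "(L * Z + R) * Q = hcat K (0\<^sub>m m (?\<nu> - dim_col K))" using comp by simp
  have "eval_mat 0 (const_mat N) = N" by (intro eq_matI) auto
  hence "eval_mat 0 (A * const_mat N) = hcat L R * N"
    using eval_mat_mult[of A m n "const_mat N" n 0] A N A0 by simp
  also have "\<dots> = hcat L (hcat K (0\<^sub>m m (?\<nu> - dim_col K)))"
    unfolding N_def hcat_mult_step_trans[OF L R cZ cQ] LZ ..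
  also have "\<dots> = hcat L' (0\<^sub>m m (n - \<rho>'))"
    unfolding L' hcat_assoc[OF L K zero_carrier_mat] \<rho>' by simp
  finally show 0: "eval_mat 0 (A * const_mat N) = hcat L' (0\<^sub>m m (n - \<rho>'))" .
  \<comment> \<open>The columns of \<open>A'\<close> from \<rho>' on are those of
    \<open>A * const_mat N\<close> divided by \<lambda>, so their values at 0 are not determined by
    \<open>L'\<close> and are merely collected here.\<close>
  define R' where "R' = mat m (n - \<rho>') (\<lambda>(i, j). poly (A' $$ (i, j + \<rho>')) 0)"
  have R': "R' \<in> carrier_mat m (n - \<rho>')" unfolding R'_def by simp
  have cL': "L' \<in> carrier_mat m \<rho>'" using cL' \<rho>' by simp
  have "eval_mat 0 A' = hcat L' R'"
  proof (rule eq_matI)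
    have c: "hcat L' R' \<in> carrier_mat m n" using hcat_carrier[OF cL' R'] \<rho>'n by simp
    thus "dim_row (eval_mat 0 A') = dim_row (hcat L' R')"
      "dim_col (eval_mat 0 A') = dim_col (hcat L' R')" using A' by auto
    fix i j assume "i < dim_row (hcat L' R')" "j < dim_col (hcat L' R')"
    hence ij: "i < m" "j < n" using c by auto
    show "eval_mat 0 A' $$ (i, j) = hcat L' R' $$ (i, j)"
    proof (cases "j < \<rho>'")
      case True
      \<comment> \<open>In these columns the diagonal factor is 1, so \<open>A'\<close> and
        \<open>A * const_mat N\<close> agree.\<close>
      have "L' $$ (i, j) = eval_mat 0 (A * const_mat N) $$ (i, j)"
        unfolding 0 using hcat_index[OF cL' zero_carrier_mat, of i j "n - \<rho>'"] ij \<rho>'n True by simp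
      also have "\<dots> = poly ((A' * step_diag [:0, 1:] n \<rho>') $$ (i, j)) 0"
        unfolding AN step_diag_eq_diag_of[OF \<rho>'n]
        using carrier_matD[OF mult_carrier_mat[OF A' diag_of_carrier]] ij
        by (simp del: index_mult_mat)
      also have "\<dots> = poly (A' $$ (i, j)) 0"
        unfolding step_diag_eq_diag_of[OF \<rho>'n] index_mult_diag_of[OF A' ij] using True by simp
      finally show ?thesis using hcat_index[OF cL' R', of i j] A' ij \<rho>'n True by simp
    next
      case False
      thus ?thesis using hcat_index[OF cL' R', of i j] A' ij \<rho>'n by (simp add: R'_def)
    qed
  qed
  thus "\<exists>R \<in> carrier_mat m (n - \<rho>'). eval_mat 0 A' = hcat L' R" using R' by blast
qed

section \<open>A complete search\<close>

lemma mat_list_prod_carrier: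
  assumes "set As \<subseteq> carrier_mat n n"
  shows "mat_list_prod n As \<in> carrier_mat n n"
  using assms unfolding mat_list_prod_def by (induction As) auto

text \<open>\<open>foldr\<close> builds the product from the right, whereas each further step of the
  search multiplies on the right; associativity reconciles the two.\<close>

lemma mat_list_prod_snoc:
  fixes As :: "'a :: semiring_1 mat list"
  assumes "set As \<subseteq> carrier_mat n n" "B \<in> carrier_mat n n"
  shows "mat_list_prod n (As @ [B]) = mat_list_prod n As * B"
  using assms(1)
proof (induction As)
  case Nil
  thus ?case using assms(2) by (simp add: mat_list_prod_def)
next
  case (Cons C As)
  have C: "C \<in> carrier_mat n n" and As: "set As \<subseteq> carrier_mat n n" using Cons.prems by auto
  have "mat_list_prod n ((C # As) @ [B]) = C * mat_list_prod n (As @ [B])"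
    by (simp add: mat_list_prod_def)
  also have "\<dots> = C * (mat_list_prod n As * B)" using Cons.IH As by simp
  also have "\<dots> = C * mat_list_prod n As * B"
    by (rule assoc_mult_mat[symmetric, OF C mat_list_prod_carrier[OF As] assms(2)])
  finally show ?case by (simp add: mat_list_prod_def)
qed

lemma unimodular_mult:
  assumes "U \<in> carrier_mat n n" "V \<in> carrier_mat n n" "unimodular U" "unimodular V"
  shows "unimodular (U * V)"
proof -
  obtain a b where "a \<noteq> 0" "det U = [:a:]" "b \<noteq> 0" "det V = [:b:]"
    using assms(3,4) unfolding unimodular_def by auto
  hence "det (U * V) = [:a * b:]" "a * b \<noteq> 0" using det_mult[OF assms(1,2)] by auto
  thus ?thesis using assms(1,2) unfolding unimodular_def square_mat.simps by auto
qed

section \<open>A fixed run and its invariants\<close>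

locale toeplitz_run =
  fixes m n d :: nat and P :: "complex poly mat"
    and A :: "nat \<Rightarrow> complex poly mat" and L Z Q :: "nat \<Rightarrow> complex mat"
  assumes P: "P \<in> carrier_mat m n" and search: "toeplitz_rank_search m n P d A L Z Q"
begin

text \<open>Shifted by one, as \<open>L\<close> is: \<open>\<rho> 0\<close> is 0, and the number of
  independent columns after step \<open>i\<close> is \<open>\<rho> (Suc i)\<close>.\<close>

abbreviation \<rho> :: "nat \<Rightarrow> nat" where "\<rho> i \<equiv> dim_col (L i)"

abbreviation N :: "nat \<Rightarrow> complex mat" where "N \<equiv> N_at n L Z Q"

lemma A_0: "A 0 = P" and L_0: "L 0 = 0\<^sub>m m 0"
  and step: "i \<le> d \<Longrightarrow> toeplitz_step m n (A i) (L i) (Z i) (Q i) (A (Suc i)) (L (Suc i))"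
  using search unfolding toeplitz_rank_search_def by auto

lemma invariants:
  assumes "i \<le> Suc d"
  shows "A i \<in> carrier_mat m n \<and> L i \<in> carrier_mat m (\<rho> i) \<and> \<rho> i \<le> n \<and> injective_mat (L i)"
  using assms
proof (induction i)
  case 0
  show ?case using P by (auto simp: A_0 L_0 injective_mat_def)
next
  case (Suc i)
  hence i: "i \<le> d" and IH: "A i \<in> carrier_mat m n" "L i \<in> carrier_mat m (\<rho> i)" "\<rho> i \<le> n"
    "injective_mat (L i)" by simp_all
  show ?case
    by (intro conjI toeplitz_step_invariants(4,5,7,8)[OF step[OF i] IH])
qed

lemma A_carrier: "i \<le> Suc d \<Longrightarrow> A i \<in> carrier_mat m n"
  and L_carrier: "i \<le> Suc d \<Longrightarrow> L i \<in> carrier_mat m (\<rho> i)"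
  and \<rho>_le: "i \<le> Suc d \<Longrightarrow> \<rho> i \<le> n"
  and L_injective: "i \<le> Suc d \<Longrightarrow> injective_mat (L i)"
  using invariants by auto

lemma step_facts:
  assumes "i \<le> d"
  shows Z_carrier: "Z i \<in> carrier_mat (\<rho> i) (n - \<rho> i)"
    and Q_carrier: "Q i \<in> carrier_mat (n - \<rho> i) (n - \<rho> i)"
    and Q_det: "det (Q i) \<noteq> 0"
    and \<rho>_Suc: "\<rho> i \<le> \<rho> (Suc i)"
    and A_N: "A i * const_mat (N i) = A (Suc i) * step_diag [:0, 1:] n (\<rho> (Suc i))"
    and A_N_0: "eval_mat 0 (A i * const_mat (N i))
                  = hcat (L (Suc i)) (0\<^sub>m m (n - \<rho> (Suc i)))"
    and A_Suc_0: "\<exists>R \<in> carrier_mat m (n - \<rho> (Suc i)). eval_mat 0 (A (Suc i)) = hcat (L (Suc i)) R"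
proof -
  have "i \<le> Suc d" using assms by simp
  note invs = toeplitz_step_invariants[OF step[OF assms] A_carrier[OF this] L_carrier[OF this]
      \<rho>_le[OF this] L_injective[OF this], folded N_at_def]
  show "Z i \<in> carrier_mat (\<rho> i) (n - \<rho> i)" "Q i \<in> carrier_mat (n - \<rho> i) (n - \<rho> i)"
    "det (Q i) \<noteq> 0" "\<rho> i \<le> \<rho> (Suc i)"
    "A i * const_mat (N i) = A (Suc i) * step_diag [:0, 1:] n (\<rho> (Suc i))"
    "eval_mat 0 (A i * const_mat (N i)) = hcat (L (Suc i)) (0\<^sub>m m (n - \<rho> (Suc i)))"
    "\<exists>R \<in> carrier_mat m (n - \<rho> (Suc i)). eval_mat 0 (A (Suc i)) = hcat (L (Suc i)) R"
    by (fact invs)+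
qed

lemma N_carrier: "i \<le> d \<Longrightarrow> N i \<in> carrier_mat n n"
  unfolding N_at_def by (intro step_trans_carrier Z_carrier Q_carrier \<rho>_le) auto

lemma \<rho>_mono:
  assumes "i \<le> k" "k \<le> Suc d"
  shows "\<rho> i \<le> \<rho> k"
  using assms
proof (induction k rule: dec_induct)
  case (step k)
  thus ?case using \<rho>_Suc[of k] by simp
qed simp

section \<open>Exponents of the accumulated diagonal factors\<close>

text \<open>The exponent of \<open>\<lambda>\<close> in column \<open>j\<close> of \<open>\<Lambda>\<^sub>0 \<cdots> \<Lambda>\<^sub>k\<^sub>-\<^sub>1\<close>.\<close>

definition expo :: "nat \<Rightarrow> nat \<Rightarrow> nat" where
  "expo k j = card {i. i < k \<and> \<rho> (Suc i) \<le> j}"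

lemma expo_Suc: "expo (Suc k) j = expo k j + (if j < \<rho> (Suc k) then 0 else 1)"
proof -
  have "{i. i < Suc k \<and> \<rho> (Suc i) \<le> j}
      = (if j < \<rho> (Suc k) then {} else {k}) \<union> {i. i < k \<and> \<rho> (Suc i) \<le> j}"
    by (auto simp: less_Suc_eq)
  thus ?thesis by (auto simp: expo_def)
qed

lemma expo_le: "expo k j \<le> k"
  by (induction k) (auto simp: expo_Suc, simp add: expo_def)

text \<open>Since \<rho> is monotone, a column at or beyond \<open>\<rho> k\<close> also lies beyond
  all earlier ranks and has received a factor \<lambda> in each of the \<open>k\<close>
  steps.\<close>

lemma expo_eq:
  assumes "k \<le> Suc d" "\<rho> k \<le> j"
  shows "expo k j = k"
proof -
  have "\<rho> (Suc i) \<le> j" if "i < k" for i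
    using \<rho>_mono[of "Suc i" k] that assms by auto
  hence "{i. i < k \<and> \<rho> (Suc i) \<le> j} = {..<k}" by auto
  thus ?thesis by (simp add: expo_def)
qed

abbreviation D :: "nat \<Rightarrow> complex poly fract mat" where
  "D k \<equiv> diag_of n (\<lambda>j. lam ^ expo k j)"

lemma Lambda_at_eq: "i \<le> d \<Longrightarrow> Lambda_at n L i = diag_of n (\<lambda>j. if j < \<rho> (Suc i) then 1 else lam)"
  unfolding Lambda_at_def rho_at_def by (intro step_diag_eq_diag_of \<rho>_le) auto

lemma Lambda_inv_at_eq:
  "i \<le> d \<Longrightarrow> Lambda_inv_at n L i = diag_of n (\<lambda>j. if j < \<rho> (Suc i) then 1 else inverse lam)"
  unfolding Lambda_inv_at_def rho_at_def by (intro step_diag_eq_diag_of \<rho>_le) auto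

lemma Lambda_at_inverse:
  "i \<le> d \<Longrightarrow> Lambda_at n L i * Lambda_inv_at n L i = 1\<^sub>m n"
  "i \<le> d \<Longrightarrow> Lambda_inv_at n L i * Lambda_at n L i = 1\<^sub>m n"
  by (auto simp: Lambda_at_eq Lambda_inv_at_eq diag_of_mult_diag_of one_mat_diag_of
      intro!: diag_of_cong)

lemma Lambda_at_carrier: "i \<le> d \<Longrightarrow> Lambda_at n L i \<in> carrier_mat n n"
  and Lambda_inv_at_carrier: "i \<le> d \<Longrightarrow> Lambda_inv_at n L i \<in> carrier_mat n n"
  by (auto simp: Lambda_at_eq Lambda_inv_at_eq)

text \<open>Diagonal matrices commute. The first order extends the product, the second puts the new
  factor next to its inverse or next to \<open>A (Suc d)\<close>.\<close>

lemma D_Suc: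
  assumes "k \<le> d"
  shows "D (Suc k) = D k * Lambda_at n L k" "D (Suc k) = Lambda_at n L k * D k"
  unfolding Lambda_at_eq[OF assms] diag_of_mult_diag_of
  by (auto intro!: diag_of_cong simp: expo_Suc)

lemma Lambda_prod_eq: "k \<le> Suc d \<Longrightarrow> Lambda_prod n L k = D k"
proof (induction k)
  case 0
  show ?case by (simp add: Lambda_prod_def mat_list_prod_def one_mat_diag_of expo_def)
next
  case (Suc k)
  have "Lambda_prod n L (Suc k) = Lambda_prod n L k * Lambda_at n L k"
    unfolding Lambda_prod_def using Suc.prems
    by (simp add: mat_list_prod_snoc Lambda_at_carrier image_subset_iff)
  thus ?case using Suc D_Suc(1)[of k] by simp
qed

lemma power_diag_eq:
  assumes "k \<le> Suc d"
  shows "power_diag k (e_at L) (n - \<rho> k) = D k"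
proof -
  define x where "x = lam"
  let ?E = "\<lambda>k. diag_block_mat (map (\<lambda>i. x ^ i \<cdot>\<^sub>m 1\<^sub>m (e_at L i)) [0..<k])"
  have const: "c \<cdot>\<^sub>m 1\<^sub>m l = diag_of l (\<lambda>_. c)" for c :: "complex poly fract" and l
    by (intro eq_matI) auto
  \<comment> \<open>Once a column is below the current rank its exponent stays fixed. The columns
    from \<open>\<rho> k\<close> to \<open>\<rho> (Suc k) - 1\<close> have just collected
    \<open>k\<close> factors, and there are \<open>e_at L k\<close> of them.\<close>
  have E: "?E k = diag_of (\<rho> k) (\<lambda>j. x ^ expo k j)" if "k \<le> Suc d" for k
    using that
  proof (induction k)
    case 0
    show ?case by (intro eq_matI) (auto simp: L_0)
  next
    case (Suc k)
    hence "\<rho> k \<le> \<rho> (Suc k)" using \<rho>_Suc[of k] by simp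
    hence sum: "\<rho> k + e_at L k = \<rho> (Suc k)" unfolding e_at_def by simp
    have "?E (Suc k) = diag_of (\<rho> k + e_at L k) (\<lambda>j. if j < \<rho> k then x ^ expo k j else x ^ k)"
      using Suc by (simp add: diag_block_mat_last Let_def const four_block_diag_of)
    also have "\<dots> = diag_of (\<rho> (Suc k)) (\<lambda>j. x ^ expo (Suc k) j)"
      unfolding sum using expo_eq[of k] Suc.prems
      by (intro diag_of_cong) (auto simp: expo_Suc not_less)
    finally show ?case .
  qed
  have "power_diag k (e_at L) (n - \<rho> k)
      = diag_of (\<rho> k + (n - \<rho> k)) (\<lambda>j. if j < \<rho> k then x ^ expo k j else x ^ k)"
    unfolding power_diag_def x_def[symmetric] using E[OF assms]
    by (simp add: diag_block_mat_last Let_def const four_block_diag_of)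
  also have "\<dots> = D k"
    unfolding x_def[symmetric] using \<rho>_le[OF assms] expo_eq[OF assms]
    by (auto intro!: diag_of_cong simp: not_less)
  finally show ?thesis .
qed

section \<open>Partial products of the transformations\<close>

text \<open>\<open>N\<^sub>0 \<Lambda>\<^sub>0\<^sup>-\<^sup>1 \<cdots> N\<^sub>k\<^sub>-\<^sub>1 \<Lambda>\<^sub>k\<^sub>-\<^sub>1\<^sup>-\<^sup>1\<close>\<close>

definition partial_trans :: "nat \<Rightarrow> complex poly fract mat" where
  "partial_trans k =
     mat_list_prod n (map (\<lambda>i. rat_mat (const_mat (N i)) * Lambda_inv_at n L i) [0..<k])"

lemma partial_trans_0: "partial_trans 0 = 1\<^sub>m n"
  by (simp add: partial_trans_def mat_list_prod_def)

lemma rat_N_carrier: "i \<le> d \<Longrightarrow> rat_mat (const_mat (N i)) \<in> carrier_mat n n"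
  using N_carrier by simp

lemma partial_trans_carrier: "k \<le> Suc d \<Longrightarrow> partial_trans k \<in> carrier_mat n n"
  unfolding partial_trans_def
  by (intro mat_list_prod_carrier)
    (auto intro!: mult_carrier_mat[OF rat_N_carrier Lambda_inv_at_carrier])

lemma partial_trans_Suc:
  assumes "k \<le> d"
  shows "partial_trans (Suc k)
    = partial_trans k * (rat_mat (const_mat (N k)) * Lambda_inv_at n L k)"
  unfolding partial_trans_def upt_Suc map_append using assms
  by (simp, intro mat_list_prod_snoc)
    (auto intro!: mult_carrier_mat[OF rat_N_carrier Lambda_inv_at_carrier])

lemma rat_A_N:
  assumes "i \<le> d"
  shows "rat_mat (A i * const_mat (N i)) = rat_mat (A (Suc i)) * Lambda_at n L i"
proof -
  have A: "A (Suc i) \<in> carrier_mat m n" and \<rho>: "\<rho> (Suc i) \<le> n"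
    using assms by (auto intro: A_carrier \<rho>_le)
  have "rat_mat (diag_of n (\<lambda>j. if j < \<rho> (Suc i) then 1 else [:0, 1:])) = Lambda_at n L i"
    unfolding Lambda_at_eq[OF assms] by (intro eq_matI) auto
  thus ?thesis
    unfolding A_N[OF assms] step_diag_eq_diag_of[OF \<rho>]
    by (simp add: to_fract_hom.mat_hom_mult[OF A diag_of_carrier])
qed

text \<open>The product telescopes: multiplying \<open>A k\<close> by \<open>N k\<close> and the
  inverse of the diagonal factor of step \<open>k\<close> yields \<open>A (Suc k)\<close>.\<close>

lemma P_partial_trans:
  assumes "k \<le> Suc d"
  shows "rat_mat P * partial_trans k = rat_mat (A k)"
  using assms
proof (induction k)
  case 0
  show ?case using P by (simp add: partial_trans_0 A_0)
next
  case (Suc k)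
  hence k: "k \<le> d" and k': "k \<le> Suc d" by auto
  let ?N = "rat_mat (const_mat (N k))" and ?I = "Lambda_inv_at n L k"
  have N: "?N \<in> carrier_mat n n" by (rule rat_N_carrier[OF k])
  have I: "?I \<in> carrier_mat n n" by (rule Lambda_inv_at_carrier[OF k])
  have rP: "rat_mat P \<in> carrier_mat m n" using P by simp
  have rA: "rat_mat (A k) \<in> carrier_mat m n" "rat_mat (A (Suc k)) \<in> carrier_mat m n"
    using A_carrier[OF k'] A_carrier[OF Suc.prems] by auto
  have "rat_mat P * partial_trans (Suc k) = rat_mat (A k) * (?N * ?I)"
    unfolding partial_trans_Suc[OF k] Suc.IH[OF k', symmetric]
    by (rule assoc_mult_mat[symmetric, OF rP partial_trans_carrier[OF k'] mult_carrier_mat[OF N I]])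
  also have "\<dots> = rat_mat (A k) * ?N * ?I" by (rule assoc_mult_mat[symmetric, OF rA(1) N I])
  also have "rat_mat (A k) * ?N = rat_mat (A (Suc k)) * Lambda_at n L k"
    unfolding rat_A_N[OF k, symmetric] using N_carrier[OF k]
    by (intro to_fract_hom.mat_hom_mult[symmetric, OF A_carrier[OF k']]) auto
  also have "\<dots> * ?I = rat_mat (A (Suc k)) * (Lambda_at n L k * ?I)"
    by (rule assoc_mult_mat[OF rA(2) Lambda_at_carrier[OF k] I])
  also have "\<dots> = rat_mat (A (Suc k))" using Lambda_at_inverse(1)[OF k] rA by simp
  finally show ?case .
qed

text \<open>\<open>N k\<close> differs from the identity only in the columns where the exponent in \<open>D k\<close> has its maximal
  value \<open>k\<close>, so \<open>D\<^sup>-\<^sup>1 N D\<close> is polynomial and keeps the determinant of \<open>N\<close>.\<close>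

lemma conjugated_step:
  assumes k: "k \<le> d"
  obtains C where "C \<in> carrier_mat n n" "unimodular C"
    "rat_mat (const_mat (N k)) * D k = D k * rat_mat C"
proof -
  define \<nu> where "\<nu> = n - \<rho> k"
  have k': "k \<le> Suc d" using k by simp
  have n: "n = \<rho> k + \<nu>" unfolding \<nu>_def using \<rho>_le[OF k'] by simp
  \<comment> \<open>Conjugation multiplies entry \<open>(i, j)\<close> by \<lambda> to the power
    \<open>expo k j - expo k i\<close>, and \<open>expo k j = k\<close> in the columns of this
    block. By \<open>expo_le\<close> the subtraction does not truncate.\<close>
  define T where "T = mat (\<rho> k) \<nu> (\<lambda>(i, j). smult ((Z k * Q k) $$ (i, j)) ([:0, 1:] ^ (k - expo k i)))"
  define C where "C = four_block_mat (1\<^sub>m (\<rho> k)) T (0\<^sub>m \<nu> (\<rho> k)) (const_mat (Q k))"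
  have T: "T \<in> carrier_mat (\<rho> k) \<nu>" unfolding T_def by simp
  have Q: "Q k \<in> carrier_mat \<nu> \<nu>" and ZQ: "Z k * Q k \<in> carrier_mat (\<rho> k) \<nu>"
    using Q_carrier[OF k] Z_carrier[OF k] unfolding \<nu>_def by auto
  have C: "C \<in> carrier_mat n n" unfolding C_def n using Q by simp
  have "det C = det (1\<^sub>m (\<rho> k)) * det (const_mat (Q k))"
    unfolding C_def by (rule det_four_block_mat_lower_left_zero) (use T Q in auto)
  also have "\<dots> = [:det (Q k):]" by (simp add: const_hom.hom_det)
  finally have "unimodular C"
    using Q_det[OF k] C unfolding unimodular_def square_mat.simps by auto
  moreover have "rat_mat (const_mat (N k)) * D k = D k * rat_mat C"
  proof (rule eq_matI)
    fix i j assume "i < dim_row (D k * rat_mat C)" "j < dim_col (D k * rat_mat C)"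
    hence ij: "i < n" "j < n" using C by auto
    have Nij: "N k $$ (i, j) = (if i < \<rho> k then if j < \<rho> k then if i = j then 1 else 0
        else (Z k * Q k) $$ (i, j - \<rho> k) else if j < \<rho> k then 0 else Q k $$ (i - \<rho> k, j - \<rho> k))"
      unfolding N_at_def step_trans_def using ij Q ZQ n by auto
    have Cij: "C $$ (i, j) = (if i < \<rho> k then if j < \<rho> k then if i = j then 1 else 0
        else smult ((Z k * Q k) $$ (i, j - \<rho> k)) ([:0, 1:] ^ (k - expo k i))
        else if j < \<rho> k then 0 else [:Q k $$ (i - \<rho> k, j - \<rho> k):])"
      unfolding C_def using ij Q T n by (auto simp: T_def)
    have split: "to_fract [:c:] * lam ^ k
        = lam ^ expo k i * to_fract (smult c ([:0, 1:] ^ (k - expo k i)))" for c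
    proof -
      have "smult c ([:0, 1:] ^ (k - expo k i)) = [:c:] * [:0, 1:] ^ (k - expo k i)" by simp
      hence "lam ^ expo k i * to_fract (smult c ([:0, 1:] ^ (k - expo k i)))
          = to_fract [:c:] * (lam ^ expo k i * lam ^ (k - expo k i))"
        by (simp only: to_fract_mult to_fract_hom.hom_power mult_ac)
      thus ?thesis using expo_le[of k i] by (simp flip: power_add)
    qed
    have "(rat_mat (const_mat (N k)) * D k) $$ (i, j) = to_fract [:N k $$ (i, j):] * lam ^ expo k j"
      using index_mult_diag_of[OF rat_N_carrier[OF k] ij] N_carrier[OF k] ij by simp
    \<comment> \<open>Left columns are identity columns, so only the diagonal matters there, with
      equal exponents; in the lower right block both exponents are \<open>k\<close>.\<close>
    also have "\<dots> = lam ^ expo k i * to_fract (C $$ (i, j))"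
    proof (cases "j < \<rho> k")
      case True
      hence "N k $$ (i, j) = (if i = j then 1 else 0)" "C $$ (i, j) = (if i = j then 1 else 0)"
        unfolding Nij Cij by auto
      thus ?thesis by (cases "i = j") simp_all
    next
      case j: False
      hence ej: "expo k j = k" using expo_eq[OF k'] by simp
      show ?thesis
      proof (cases "i < \<rho> k")
        case True
        thus ?thesis unfolding Nij Cij ej using j split by simp
      next
        case False
        hence "expo k i = k" using expo_eq[OF k'] by simp
        thus ?thesis unfolding Nij Cij ej using j False by (simp add: mult.commute)
      qed
    qed
    also have "\<dots> = (D k * rat_mat C) $$ (i, j)"
      using index_diag_of_mult[of "rat_mat C" n n i j] C ij by simp
    finally show "(rat_mat (const_mat (N k)) * D k) $$ (i, j) = (D k * rat_mat C) $$ (i, j)" .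
  qed (use C N_carrier[OF k] in auto)
  ultimately show ?thesis using that C by blast
qed

text \<open>In \<open>D (Suc k)\<close> the newest diagonal factor cancels the inverse just
  appended, and \<open>N k\<close> moves past \<open>D k\<close> as the unimodular \<open>C\<close>.
  Each step thus multiplies the polynomial matrix on the right by a unimodular one.\<close>

lemma partial_trans_unimodular:
  assumes "k \<le> Suc d"
  shows "\<exists>U \<in> carrier_mat n n. partial_trans k * D k = rat_mat U \<and> unimodular U"
  using assms
proof (induction k)
  case 0
  have "rat_mat (1\<^sub>m n) = (1\<^sub>m n :: complex poly fract mat)" by (rule to_fract_hom.mat_hom_one)
  moreover have "unimodular (1\<^sub>m n)" by (auto simp: unimodular_def intro!: exI[of _ 1])
  moreover have "partial_trans 0 * D 0 = 1\<^sub>m n"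
    by (simp add: partial_trans_0 expo_def flip: one_mat_diag_of)
  ultimately show ?case by (intro bexI[of _ "1\<^sub>m n"]) auto
next
  case (Suc k)
  hence k: "k \<le> d" and k': "k \<le> Suc d" by auto
  let ?N = "rat_mat (const_mat (N k))" and ?I = "Lambda_inv_at n L k"
  have N: "?N \<in> carrier_mat n n" by (rule rat_N_carrier[OF k])
  have I: "?I \<in> carrier_mat n n" by (rule Lambda_inv_at_carrier[OF k])
  note T = partial_trans_carrier[OF k']
  obtain U where U: "U \<in> carrier_mat n n" "partial_trans k * D k = rat_mat U" "unimodular U"
    using Suc.IH[OF k'] by auto
  obtain C where C: "C \<in> carrier_mat n n" "unimodular C" "?N * D k = D k * rat_mat C"
    using conjugated_step[OF k] .
  have "?N * ?I * D (Suc k) = ?N * (?I * (Lambda_at n L k * D k))"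
    unfolding D_Suc(2)[OF k] using Lambda_at_carrier[OF k]
    by (intro assoc_mult_mat[OF N I]) (auto intro: mult_carrier_mat[OF _ diag_of_carrier])
  also have "?I * (Lambda_at n L k * D k) = ?I * Lambda_at n L k * D k"
    by (rule assoc_mult_mat[symmetric, OF I Lambda_at_carrier[OF k] diag_of_carrier])
  also have "\<dots> = D k" unfolding Lambda_at_inverse(2)[OF k] by simp
  finally have NI: "?N * ?I * D (Suc k) = D k * rat_mat C" using C(3) by simp
  have "partial_trans (Suc k) * D (Suc k) = partial_trans k * (?N * ?I * D (Suc k))"
    unfolding partial_trans_Suc[OF k]
    by (rule assoc_mult_mat[OF T mult_carrier_mat[OF N I] diag_of_carrier])
  also have "\<dots> = partial_trans k * D k * rat_mat C"
    unfolding NI using C(1) by (intro assoc_mult_mat[symmetric, OF T diag_of_carrier]) simp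
  also have "\<dots> = rat_mat (U * C)"
    unfolding U(2) by (rule to_fract_hom.mat_hom_mult[symmetric, OF U(1) C(1)])
  finally show ?case using unimodular_mult[OF U(1) C(1) U(3) C(2)] U(1) C(1)
    by (intro bexI[of _ "U * C"]) auto
qed

section \<open>The factorization and its value at 0\<close>

lemma N_total_eq: "N_total n L Z Q d = partial_trans (Suc d) * Lambda_prod n L (Suc d)"
  unfolding N_total_def partial_trans_def ..

lemma factorization:
  "rat_mat P * N_total n L Z Q d = rat_mat (A (Suc d)) * Lambda_prod n L (Suc d)"
proof -
  have "rat_mat P * N_total n L Z Q d = rat_mat P * partial_trans (Suc d) * D (Suc d)"
    unfolding N_total_eq Lambda_prod_eq[OF order_refl] using P
    by (intro assoc_mult_mat[symmetric, OF _ partial_trans_carrier diag_of_carrier]) auto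
  thus ?thesis unfolding P_partial_trans[OF order_refl] Lambda_prod_eq[OF order_refl] .
qed

text \<open>The last diagonal factor moves from the right factor into the left one, where
  \<open>rat_A_N\<close> turns it into \<open>A d * const_mat (N d)\<close>.\<close>

lemma factorization_previous:
  "rat_mat P * N_total n L Z Q d = rat_mat (A d * const_mat (N d)) * Lambda_prod n L d"
proof -
  have A: "rat_mat (A (Suc d)) \<in> carrier_mat m n" using A_carrier by simp
  show ?thesis
    unfolding factorization rat_A_N[OF order_refl] Lambda_prod_eq[OF order_refl]
      Lambda_prod_eq[OF le_SucI[OF order_refl]] D_Suc(2)[OF order_refl]
    by (rule assoc_mult_mat[symmetric, OF A Lambda_at_carrier[OF order_refl] diag_of_carrier])
qed

lemma N_total_unimodular:
  "\<exists>U \<in> carrier_mat n n. N_total n L Z Q d = rat_mat U \<and> unimodular U"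
  using partial_trans_unimodular[OF order_refl] unfolding N_total_eq Lambda_prod_eq[OF order_refl] .

text \<open>The embedding into rational functions is injective, so the identity descends to
  polynomials, where it can be combined with evaluation at 0.\<close>

lemma polynomial_factorization:
  assumes U: "U \<in> carrier_mat n n" "N_total n L Z Q d = rat_mat U"
  shows "P * U = A (Suc d) * diag_of n (\<lambda>j. [:0, 1:] ^ expo (Suc d) j)"
proof -
  have A: "A (Suc d) \<in> carrier_mat m n" by (rule A_carrier) simp
  have "rat_mat (diag_of n (\<lambda>j. [:0, 1:] ^ expo (Suc d) j)) = D (Suc d)"
    by (intro eq_matI) (auto simp: to_fract_hom.hom_power)
  hence "rat_mat (P * U) = rat_mat (A (Suc d) * diag_of n (\<lambda>j. [:0, 1:] ^ expo (Suc d) j))"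
    using factorization
    unfolding to_fract_hom.mat_hom_mult[OF P U(1)] to_fract_hom.mat_hom_mult[OF A diag_of_carrier]
      U(2) Lambda_prod_eq[OF order_refl] by simp
  thus ?thesis by (rule to_fract_hom.mat_hom_inj)
qed

lemma final_columns:
  assumes \<sigma>: "structural_indices 0 (rat_mat P) \<sigma>" and d: "\<And>s. s \<in> set \<sigma> \<Longrightarrow> s \<le> int d"
    and R: "R \<in> carrier_mat m (n - \<rho> (Suc d))" "eval_mat 0 (A (Suc d)) = hcat (L (Suc d)) R"
  shows "\<rho> (Suc d) = length \<sigma>"
    "\<exists>Y \<in> carrier_mat (\<rho> (Suc d)) (n - \<rho> (Suc d)). R = L (Suc d) * Y"
proof -
  obtain U where U: "U \<in> carrier_mat n n" "N_total n L Z Q d = rat_mat U" "unimodular U"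
    using N_total_unimodular by auto
  have dU: "poly (det U) 0 \<noteq> 0" using U(3) unfolding unimodular_def by auto
  \<comment> \<open>The steps \<open>0\<close> to \<open>d\<close> contribute \<open>Suc d\<close>
    factors \<lambda> to these columns, one more than the largest structural index; this makes the
    inequality strict.\<close>
  have f: "s < int (expo (Suc d) j)" if "s \<in> set \<sigma>" "\<rho> (Suc d) \<le> j" for s j
    using expo_eq[OF order_refl that(2)] d[OF that(1)] by simp
  note rank_at_zero_of_factor[OF P \<sigma> U(1) dU A_carrier[OF order_refl]
      polynomial_factorization[OF U(1,2)] \<rho>_le[OF order_refl] f L_carrier[OF order_refl]
      L_injective[OF order_refl] R]
  thus "\<rho> (Suc d) = length \<sigma>"
    "\<exists>Y \<in> carrier_mat (\<rho> (Suc d)) (n - \<rho> (Suc d)). R = L (Suc d) * Y" by auto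
qed

text \<open>Serves both normalizations: a general \<open>Y\<close> for \<open>A (Suc d)\<close> at
  0, and \<open>Y = 0\<close> for \<open>A d * const_mat (N d)\<close>.\<close>

lemma rank_and_nullity:
  assumes Y: "Y \<in> carrier_mat (\<rho> (Suc d)) (n - \<rho> (Suc d))"
    and B: "B = hcat (L (Suc d)) (L (Suc d) * Y)"
  shows "vec_space.rank m B = \<rho> (Suc d)" "kernel_dim B = n - \<rho> (Suc d)"
proof -
  note L = L_carrier[OF order_refl]
  have "B \<in> carrier_mat m n"
    using hcat_carrier[OF L mult_carrier_mat[OF L Y]] \<rho>_le[OF order_refl] unfolding B by simp
  moreover have "vec_space.rank m B = \<rho> (Suc d)"
    unfolding B rank_hcat_mult[OF L Y] using rank_eq_dim_col_iff[OF L] L_injective by simp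
  ultimately show "vec_space.rank m B = \<rho> (Suc d)" "kernel_dim B = n - \<rho> (Suc d)"
    using rank_plus_kernel_dim[of B m n] by auto
qed

end

theorem theorem3p2:
  fixes P :: "complex poly mat" and m n r d' :: nat and \<sigma> :: "int list"
    and A :: "nat \<Rightarrow> complex poly mat" and L Z Q :: "nat \<Rightarrow> complex mat"
  assumes "P \<in> carrier_mat m n"
    and "normal_rank (rat_mat P) = r"
    and "structural_indices 0 (rat_mat P) \<sigma>"
    and "r > 0 \<Longrightarrow> int d' = Max (set \<sigma>)"
    and "toeplitz_rank_search m n P d' A L Z Q"
  shows
    "(let N = N_total n L Z Q d'; \<Lambda> = Lambda_prod n L (Suc d');
          L\<^sub>d = L (Suc d'); A\<^sub>d = A (Suc d') in
        rat_mat P * N = rat_mat A\<^sub>d * \<Lambda>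
      \<and> (\<exists>U \<in> carrier_mat n n. N = rat_mat U \<and> unimodular U)
      \<and> \<Lambda> = power_diag (Suc d') (e_at L) (nu_at n L d')
      \<and> (\<exists>R \<in> carrier_mat m (nu_at n L d'). eval_mat 0 A\<^sub>d = hcat L\<^sub>d R)
      \<and> vec_space.rank m (eval_mat 0 A\<^sub>d) = r
      \<and> kernel_dim (eval_mat 0 A\<^sub>d) = n - r)
   \<and> (let N = N_total n L Z Q d'; \<Lambda> = Lambda_prod n L d';
          L\<^sub>d = L (Suc d'); A\<^sub>d = A d' * const_mat (N_at n L Z Q d') in
        rat_mat P * N = rat_mat A\<^sub>d * \<Lambda>
      \<and> \<Lambda> = power_diag d' (e_at L) (n - dim_col (L d'))
      \<and> eval_mat 0 A\<^sub>d = hcat L\<^sub>d (0\<^sub>m m (nu_at n L d'))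
      \<and> vec_space.rank m (eval_mat 0 A\<^sub>d) = r
      \<and> kernel_dim (eval_mat 0 A\<^sub>d) = n - r)"
proof -
  interpret toeplitz_run m n d' P A L Z Q by unfold_locales (fact assms)+
  have len: "length \<sigma> = r" using assms(2,3) unfolding structural_indices_def by simp
  \<comment> \<open>For \<open>r = 0\<close> the list \<sigma> is empty and the bound is vacuous, so
    \<open>Max\<close> is only consulted on a nonempty set.\<close>
  have d: "s \<le> int d'" if "s \<in> set \<sigma>" for s
  proof -
    have "r > 0" using that len by (cases \<sigma>) auto
    thus ?thesis using assms(4) that by simp
  qed
  have \<nu>: "nu_at n L d' = n - \<rho> (Suc d')" by (simp add: nu_at_def rho_at_def)
  obtain R where R: "R \<in> carrier_mat m (n - \<rho> (Suc d'))"
    "eval_mat 0 (A (Suc d')) = hcat (L (Suc d')) R"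
    using A_Suc_0[OF order_refl] by auto
  note fin = final_columns[OF assms(3) d R]
  obtain Y where Y: "Y \<in> carrier_mat (\<rho> (Suc d')) (n - \<rho> (Suc d'))" "R = L (Suc d') * Y"
    using fin(2) by auto
  \<comment> \<open>Writing the zero block as a multiple of \<open>L (Suc d')\<close> brings the
    second normalization into the form whose rank is known.\<close>
  have zero: "0\<^sub>m m (n - \<rho> (Suc d')) = L (Suc d') * 0\<^sub>m (\<rho> (Suc d')) (n - \<rho> (Suc d'))"
    by (rule right_mult_zero_mat[symmetric, OF L_carrier]) simp
  note rank1 = rank_and_nullity[OF Y(1) R(2)[unfolded Y(2)]]
  note rank2 = rank_and_nullity[OF zero_carrier_mat A_N_0[OF order_refl, unfolded zero]]
  have \<rho>: "\<rho> (Suc d') = r" using fin(1) len by simp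
  show ?thesis
    unfolding Let_def \<nu>
  proof (intro conjI)
    show "\<exists>R \<in> carrier_mat m (n - \<rho> (Suc d')). eval_mat 0 (A (Suc d')) = hcat (L (Suc d')) R"
      using R by blast
    show "Lambda_prod n L (Suc d') = power_diag (Suc d') (e_at L) (n - \<rho> (Suc d'))"
      "Lambda_prod n L d' = power_diag d' (e_at L) (n - \<rho> d')"
      by (simp_all add: Lambda_prod_eq power_diag_eq)
  qed (fact factorization factorization_previous N_total_unimodular A_N_0[OF order_refl]
      rank1[unfolded \<rho>] rank2[unfolded \<rho>])+
qed

end
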